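(* Let $\nu\in M_{\chi_\alpha,\sigma}(E)$ and let $\tau$ be a fixed admissible product gauge for $\nu$. Set $$s_\tau:=\varsigma_\tau(\Sigma_\tau)=\frac1{d_\alpha}\int_{\{\tau\in C_\star\}}\chi_\alpha(\tau(x))\,\nu(dx)=\frac{\nu\{\tau\in C_\star\}}{\vartheta_\alpha(C_\star)}\in(0,\infty]$$ (these equalities being part of the assertion). Every stochastic representer $Z$ of $\nu$ satisfies $\mathbb E\{\chi_\alpha(R_Z)\}=s_\tau$. The following are equivalent: (i) Some stochastic representer $Z$ of $\nu$ has $R_Z$ and $Y_Z$ independent. (ii) $s_\tau<\infty$. (iii) $\nu\{\tau\in C_\star\}<\infty$. If $s_\tau<\infty$, put $\bar\alpha:=\sum_{i=1}^q\alpha_i$ and $a_\tau:=s_\tau^{1/\bar\alpha}\boldsymbol 1\in G$, and for any stochastic representer $Z$ of $\nu$, defined on a probability space with probability measure $\mathbb P$, define $$\frac{d\mathbb P_Z^\tau}{d\mathbb P}:=\frac{\chi_\alpha(R_Z)}{s_\tau},\qquad Z_\tau^\circ:=S_{a_\tau}Y_Z=S_{a_\tau R_Z^{-1}}Z$$ (the last equality holding almost surely). Under $\mathbb P_Z^\tau$, $$Y_Z\sim\frac{\varsigma_\tau}{s_\tau},\qquad \tau(Z_\tau^\circ)=a_\tau,\qquad \nu_{Z_\tau^\circ}=\nu,$$ and the law of $Z_\tau^\circ$ is $(S_{a_\tau})_\#(\varsigma_\tau/s_\tau)$. Consequently, every stochastic representer $W$ of $\nu$ satisfying $\tau(W)=a_\tau$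 almost surely has this law. Finally (with $s_\tau<\infty$), for every $E$-valued random element $Z$ concentrated on $E_\tau$ with $R_Z$ and $Y_Z$ independent, $$\nu_Z=\nu\quad\Longleftrightarrow\quad Y_Z\sim\frac{\varsigma_\tau}{s_\tau}\ \text{ and }\ \mathbb E\{\chi_\alpha(R_Z)\}=s_\tau.$$
   Context: Let $q\ge1$ be an integer, $(E,\mathcal E)$ an arbitrary measurable space, and $G=(0,\infty)^q$ with coordinatewise multiplication and its Borel $\sigma$-field. Let $S:G\times E\to E$, $(r,x)\mapsto S_rx$, be a jointly measurable left action: $S_{\boldsymbol 1}x=x$ with $\boldsymbol 1=(1,\ldots,1)$, and $S_r(S_sx)=S_{rs}x$. Fix $\alpha\in(0,\infty)^q$ and put $\chi_\alpha(r)=\prod_{i=1}^q r_i^{\alpha_i}$, $\vartheta_\alpha(dr)=\prod_{i=1}^q\alpha_i r_i^{-\alpha_i-1}\,dr_i$ and $m_\alpha(dr)=\prod_{i=1}^q\alpha_i\,dr_i/r_i$ (measures on $G$). A measure $\nu$ on $(E,\mathcal E)$ is $\chi_\alpha$-homogeneous if $\nu(S_rA)=\chi_\alpha(r)^{-1}\nu(A)$ for all $r\in G$, $A\in\mathcal E$. $M_{\chi_\alpha,\sigma}(E)$ is the set of nonzero $\sigma$-finite $\chi_\alpha$-homogeneous measures. For an $E$-valued random element $Z$, $\nu_Z(A)=\mathbb E\left\{\int_G\mathbb I_A(S_rZ)\,\vartheta_\alpha(dr)\right\}$, $A\in\mathcal E$ (expectation under the probability measure in force for $Z$); $Z$ is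 a stochastic representer of $\nu$ if $\nu=\nu_Z$. A product gauge is a measurable map $\tau=(\tau_1,\ldots,\tau_q):E\to[0,\infty)^q$ with $\tau(S_rx)=r\tau(x)$ (coordinatewise product) for all $r\in G$, $x\in E$; with $E_\tau:=\bigcap_{i=1}^q\{\tau_i>0\}$, it is admissible for $\nu$ if $\nu(E\setminus E_\tau)=0$. Given an admissible product gauge $\tau$ for $\nu$, put $\Sigma_\tau=\{x\in E_\tau:\tau(x)=\boldsymbol 1\}$ (nonempty), equipped with the trace $\sigma$-field $\mathcal E|_{\Sigma_\tau}$. Set $\Pi_\tau x=S_{\tau(x)^{-1}}x$ for $x\in E_\tau$ and $\Pi_\tau x=w_\tau$ for $x\notin E_\tau$, where $w_\tau\in\Sigma_\tau$ is fixed. Put $C_\star=(1,2]^q$, $d_\alpha=m_\alpha(C_\star)$, $h_\tau=d_\alpha^{-1}\mathbb I_{\{\tau\in C_\star\}}$, and let $\varsigma_\tau$ be the measure on $\Sigma_\tau$ given by $\varsigma_\tau(D)=\int_{E_\tau}\chi_\alpha(\tau(x))\,h_\tau(x)\,\mathbb I_{\{\Pi_\tau x\in D\}}\,\nu(dx)$, $D\in\mathcal E|_{\Sigma_\tau}$. A random element $Z$ is concentrated on $E_\tau$ if $\mathbb P\{Z\in E_\tau\}=1$; every stochastic representer of $\nu$ is concentrated on $E_\tau$. Put $R_Z=\tau(Z)$ and $Y_Z=\Pi_\tau Z$. For a measurable map $T$ and a measure $\mu$, $(T_\#\mu)(A)=\mu(T^{-1}A)$; here $(S_{a_\tau})_\#(\varsigma_\tau/s_\tau)$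 is the image of the probability measure $\varsigma_\tau/s_\tau$ on $\Sigma_\tau$ under $y\mapsto S_{a_\tau}y\in E$. *)

theory Defs
  imports "HOL-Probability.Probability"
begin

text \<open>
  The index set of the \<open>q\<close> coordinates is a finite type \<open>'q\<close> (so \<open>q = CARD('q) \<ge> 1\<close>).
  Multiplication and \<open>1\<close> on \<^typ>\<open>real ^ 'q\<close> are the coordinatewise ones of the library.
  A measurable space is represented by a measure \<open>M\<close> of which only \<open>space M\<close> and \<open>sets M\<close> are used.
\<close>

definition pos_orthant :: "(real ^ 'q) set" where
  "pos_orthant = {r. \<forall>i. 0 < r $ i}"

definition vec_inv :: "real ^ 'q \<Rightarrow> real ^ 'q" where
  "vec_inv r = (\<chi> i. inverse (r $ i))"

definition chi :: "real ^ 'q \<Rightarrow> real ^ 'q \<Rightarrow> real" where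
  "chi \<alpha> r = (\<Prod>i\<in>UNIV. (r $ i) powr (\<alpha> $ i))"

definition theta :: "real ^ 'q \<Rightarrow> (real ^ 'q) measure" where
  "theta \<alpha> = density (restrict_space lborel pos_orthant)
     (\<lambda>r. ennreal (\<Prod>i\<in>UNIV. \<alpha> $ i * (r $ i) powr (- (\<alpha> $ i) - 1)))"

definition haar :: "real ^ 'q \<Rightarrow> (real ^ 'q) measure" where
  "haar \<alpha> = density (restrict_space lborel pos_orthant)
     (\<lambda>r. ennreal (\<Prod>i\<in>UNIV. \<alpha> $ i / r $ i))"

definition measurable_action :: "'e measure \<Rightarrow> (real ^ 'q \<Rightarrow> 'e \<Rightarrow> 'e) \<Rightarrow> bool" where
  "measurable_action M S \<longleftrightarrow>
     (\<lambda>(r, x). S r x) \<in> restrict_space borel pos_orthant \<Otimes>\<^sub>M M \<rightarrow>\<^sub>M M \<and>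
     (\<forall>x\<in>space M. S 1 x = x) \<and>
     (\<forall>r\<in>pos_orthant. \<forall>s\<in>pos_orthant. \<forall>x\<in>space M. S r (S s x) = S (r * s) x)"

definition homogeneous_measures ::
  "'e measure \<Rightarrow> (real ^ 'q \<Rightarrow> 'e \<Rightarrow> 'e) \<Rightarrow> real ^ 'q \<Rightarrow> 'e measure set" where
  "homogeneous_measures M S \<alpha> = {\<nu>. sets \<nu> = sets M \<and> sigma_finite_measure \<nu> \<and>
     emeasure \<nu> (space \<nu>) \<noteq> 0 \<and>
     (\<forall>r\<in>pos_orthant. \<forall>A\<in>sets M.
        emeasure \<nu> (S r ` A) = ennreal (inverse (chi \<alpha> r)) * emeasure \<nu> A)}"

text \<open>The set function below is countably additive (see \<open>emeasure_orbit_measure\<close>), so that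
  \<^const>\<open>measure_of\<close> does not collapse; the same remark applies to \<open>varsigma\<close>.\<close>

definition orbit_measure ::
  "'e measure \<Rightarrow> (real ^ 'q \<Rightarrow> 'e \<Rightarrow> 'e) \<Rightarrow> real ^ 'q \<Rightarrow> 'w measure \<Rightarrow> ('w \<Rightarrow> 'e) \<Rightarrow> 'e measure" where
  "orbit_measure M S \<alpha> P Z = measure_of (space M) (sets M)
     (\<lambda>A. \<integral>\<^sup>+\<omega>. (\<integral>\<^sup>+r. indicator A (S r (Z \<omega>)) \<partial>theta \<alpha>) \<partial>P)"

definition random_element :: "'w measure \<Rightarrow> 'e measure \<Rightarrow> ('w \<Rightarrow> 'e) \<Rightarrow> bool" where
  "random_element P M Z \<longleftrightarrow> prob_space P \<and> Z \<in> P \<rightarrow>\<^sub>M M"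

definition stochastic_representer ::
  "'e measure \<Rightarrow> (real ^ 'q \<Rightarrow> 'e \<Rightarrow> 'e) \<Rightarrow> real ^ 'q \<Rightarrow> 'e measure \<Rightarrow>
   'w measure \<Rightarrow> ('w \<Rightarrow> 'e) \<Rightarrow> bool" where
  "stochastic_representer M S \<alpha> \<nu> P Z \<longleftrightarrow>
     random_element P M Z \<and> \<nu> = orbit_measure M S \<alpha> P Z"

text \<open>The library's \<open>indep_var\<close> forces both variables to have the same range type, hence this
  two-type version, stated through the library's \<^const>\<open>prob_space.indep_set\<close>.\<close>

definition independent_elements ::
  "'w measure \<Rightarrow> 'b measure \<Rightarrow> ('w \<Rightarrow> 'b) \<Rightarrow> 'c measure \<Rightarrow> ('w \<Rightarrow> 'c) \<Rightarrow> bool" where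
  "independent_elements P N X N' Y \<longleftrightarrow>
     X \<in> P \<rightarrow>\<^sub>M N \<and> Y \<in> P \<rightarrow>\<^sub>M N' \<and>
     prob_space.indep_set P {X -` A \<inter> space P |A. A \<in> sets N} {Y -` B \<inter> space P |B. B \<in> sets N'}"

definition product_gauge ::
  "'e measure \<Rightarrow> (real ^ 'q \<Rightarrow> 'e \<Rightarrow> 'e) \<Rightarrow> ('e \<Rightarrow> real ^ 'q) \<Rightarrow> bool" where
  "product_gauge M S \<tau> \<longleftrightarrow>
     \<tau> \<in> M \<rightarrow>\<^sub>M borel \<and> (\<forall>x\<in>space M. \<forall>i. 0 \<le> \<tau> x $ i) \<and>
     (\<forall>r\<in>pos_orthant. \<forall>x\<in>space M. \<tau> (S r x) = r * \<tau> x)"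

definition gauge_dom :: "'e measure \<Rightarrow> ('e \<Rightarrow> real ^ 'q) \<Rightarrow> 'e set" where
  "gauge_dom M \<tau> = {x\<in>space M. \<forall>i. 0 < \<tau> x $ i}"

definition admissible_gauge ::
  "'e measure \<Rightarrow> (real ^ 'q \<Rightarrow> 'e \<Rightarrow> 'e) \<Rightarrow> 'e measure \<Rightarrow> ('e \<Rightarrow> real ^ 'q) \<Rightarrow> bool" where
  "admissible_gauge M S \<nu> \<tau> \<longleftrightarrow>
     product_gauge M S \<tau> \<and> emeasure \<nu> (space M - gauge_dom M \<tau>) = 0"

definition gauge_section :: "'e measure \<Rightarrow> ('e \<Rightarrow> real ^ 'q) \<Rightarrow> 'e set" where
  "gauge_section M \<tau> = {x\<in>gauge_dom M \<tau>. \<tau> x = 1}"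

definition section_space :: "'e measure \<Rightarrow> ('e \<Rightarrow> real ^ 'q) \<Rightarrow> 'e measure" where
  "section_space M \<tau> = restrict_space M (gauge_section M \<tau>)"

definition section_proj ::
  "'e measure \<Rightarrow> (real ^ 'q \<Rightarrow> 'e \<Rightarrow> 'e) \<Rightarrow> ('e \<Rightarrow> real ^ 'q) \<Rightarrow> 'e \<Rightarrow> 'e \<Rightarrow> 'e" where
  "section_proj M S \<tau> w x = (if x \<in> gauge_dom M \<tau> then S (vec_inv (\<tau> x)) x else w)"

definition C_star :: "(real ^ 'q) set" where
  "C_star = {r. \<forall>i. 1 < r $ i \<and> r $ i \<le> 2}"

definition d_const :: "real ^ 'q \<Rightarrow> ennreal" where
  "d_const \<alpha> = emeasure (haar \<alpha>) C_star"

definition h_weight :: "real ^ 'q \<Rightarrow> ('e \<Rightarrow> real ^ 'q) \<Rightarrow> 'e \<Rightarrow> ennreal" where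
  "h_weight \<alpha> \<tau> x = inverse (d_const \<alpha>) * indicator C_star (\<tau> x)"

definition varsigma ::
  "'e measure \<Rightarrow> (real ^ 'q \<Rightarrow> 'e \<Rightarrow> 'e) \<Rightarrow> real ^ 'q \<Rightarrow> 'e measure \<Rightarrow>
   ('e \<Rightarrow> real ^ 'q) \<Rightarrow> 'e \<Rightarrow> 'e measure" where
  "varsigma M S \<alpha> \<nu> \<tau> w =
     measure_of (space (section_space M \<tau>)) (sets (section_space M \<tau>))
       (\<lambda>D. \<integral>\<^sup>+x\<in>gauge_dom M \<tau>. (ennreal (chi \<alpha> (\<tau> x)) * h_weight \<alpha> \<tau> x *
              indicator D (section_proj M S \<tau> w x)) \<partial>\<nu>)"

definition s_const ::
  "'e measure \<Rightarrow> (real ^ 'q \<Rightarrow> 'e \<Rightarrow> 'e) \<Rightarrow> real ^ 'q \<Rightarrow> 'e measure \<Rightarrow>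
   ('e \<Rightarrow> real ^ 'q) \<Rightarrow> 'e \<Rightarrow> ennreal" where
  "s_const M S \<alpha> \<nu> \<tau> w = emeasure (varsigma M S \<alpha> \<nu> \<tau> w) (gauge_section M \<tau>)"

definition varsigma_normalized ::
  "'e measure \<Rightarrow> (real ^ 'q \<Rightarrow> 'e \<Rightarrow> 'e) \<Rightarrow> real ^ 'q \<Rightarrow> 'e measure \<Rightarrow>
   ('e \<Rightarrow> real ^ 'q) \<Rightarrow> 'e \<Rightarrow> 'e measure" where
  "varsigma_normalized M S \<alpha> \<nu> \<tau> w =
     scale_measure (inverse (s_const M S \<alpha> \<nu> \<tau> w)) (varsigma M S \<alpha> \<nu> \<tau> w)"

text \<open>Only meaningful when \<^const>\<open>s_const\<close> is finite, because of \<^const>\<open>enn2real\<close>.\<close>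

definition a_vec ::
  "'e measure \<Rightarrow> (real ^ 'q \<Rightarrow> 'e \<Rightarrow> 'e) \<Rightarrow> real ^ 'q \<Rightarrow> 'e measure \<Rightarrow>
   ('e \<Rightarrow> real ^ 'q) \<Rightarrow> 'e \<Rightarrow> real ^ 'q" where
  "a_vec M S \<alpha> \<nu> \<tau> w =
     (\<chi> i. enn2real (s_const M S \<alpha> \<nu> \<tau> w) powr (1 / (\<Sum>j\<in>UNIV. \<alpha> $ j)))"

definition tilted_measure ::
  "'e measure \<Rightarrow> (real ^ 'q \<Rightarrow> 'e \<Rightarrow> 'e) \<Rightarrow> real ^ 'q \<Rightarrow> 'e measure \<Rightarrow>
   ('e \<Rightarrow> real ^ 'q) \<Rightarrow> 'e \<Rightarrow> 'w measure \<Rightarrow> ('w \<Rightarrow> 'e) \<Rightarrow> 'w measure" where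
  "tilted_measure M S \<alpha> \<nu> \<tau> w P Z =
     density P (\<lambda>\<omega>. ennreal (chi \<alpha> (\<tau> (Z \<omega>))) / s_const M S \<alpha> \<nu> \<tau> w)"

definition Z_circ ::
  "'e measure \<Rightarrow> (real ^ 'q \<Rightarrow> 'e \<Rightarrow> 'e) \<Rightarrow> real ^ 'q \<Rightarrow> 'e measure \<Rightarrow>
   ('e \<Rightarrow> real ^ 'q) \<Rightarrow> 'e \<Rightarrow> ('w \<Rightarrow> 'e) \<Rightarrow> 'w \<Rightarrow> 'e" where
  "Z_circ M S \<alpha> \<nu> \<tau> w Z \<omega> = S (a_vec M S \<alpha> \<nu> \<tau> w) (section_proj M S \<tau> w (Z \<omega>))"

lemma borel_measurable_nth [measurable (raw)]:
  fixes f :: "'a \<Rightarrow> real ^ 'q"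
  assumes "f \<in> borel_measurable M"
  shows "(\<lambda>x. f x $ i) \<in> borel_measurable M"
proof -
  have "(\<lambda>r :: real ^ 'q. r $ i) \<in> borel_measurable borel"
    by (intro borel_measurable_continuous_onI continuous_on_component continuous_on_id)
  from measurable_compose[OF assms this] show ?thesis .
qed

lemma borel_pos_orthant [measurable]: "(pos_orthant :: (real ^ 'q) set) \<in> sets borel"
proof -
  have "{r \<in> space borel. \<forall>i. 0 < (r :: real ^ 'q) $ i} \<in> sets borel"
    by measurable
  then show ?thesis by (simp add: pos_orthant_def)
qed

lemma sets_C_star [measurable]: "(C_star :: (real ^ 'q) set) \<in> sets borel"
proof -
  have "{r \<in> space borel. \<forall>i. 1 < (r :: real ^ 'q) $ i \<and> r $ i \<le> 2} \<in> sets borel"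
    by measurable
  then show ?thesis by (simp add: C_star_def)
qed

lemma borel_measurable_chi [measurable]: "chi \<alpha> \<in> borel_measurable borel"
  unfolding chi_def by measurable

lemma sets_theta: "sets (theta \<alpha>) = sets (restrict_space borel pos_orthant)"
  unfolding theta_def sets_density by (intro sets_restrict_space_cong sets_lborel)

lemma sigma_finite_theta: "sigma_finite_measure (theta (\<alpha> :: real ^ 'q))"
proof -
  interpret L: sigma_finite_measure "restrict_space lborel (pos_orthant :: (real ^ 'q) set)"
    by (rule sigma_finite_measure_restrict_space) (simp_all add: sigma_finite_lborel borel_pos_orthant)
  have "(\<lambda>r. ennreal (\<Prod>i\<in>UNIV. \<alpha> $ i * (r $ i) powr (- (\<alpha> $ i) - 1)))
      \<in> borel_measurable (borel :: (real ^ 'q) measure)"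
    by measurable
  then have "(\<lambda>r. ennreal (\<Prod>i\<in>UNIV. \<alpha> $ i * (r $ i) powr (- (\<alpha> $ i) - 1)))
      \<in> borel_measurable (restrict_space lborel (pos_orthant :: (real ^ 'q) set))"
    by (intro measurable_restrict_space1) simp
  from L.sigma_finite_iff_density_finite[OF this] show ?thesis
    unfolding theta_def by simp
qed

lemma emeasure_orbit_measure:
  assumes S: "measurable_action M S" and Z: "Z \<in> P \<rightarrow>\<^sub>M M" and A: "A \<in> sets M"
  shows "emeasure (orbit_measure M S \<alpha> P Z) A =
    (\<integral>\<^sup>+\<omega>. (\<integral>\<^sup>+r. indicator A (S r (Z \<omega>)) \<partial>theta \<alpha>) \<partial>P)"
proof -
  interpret T: sigma_finite_measure "theta \<alpha>" by (rule sigma_finite_theta)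
  note sets_theta[measurable_cong]
  have [measurable]: "(\<lambda>(r, x). S r x) \<in> theta \<alpha> \<Otimes>\<^sub>M M \<rightarrow>\<^sub>M M"
    using S unfolding measurable_action_def
    by (simp add: sets_theta cong: measurable_cong_sets sets_pair_measure_cong)
  note Z[measurable]
  have SZ: "(\<lambda>(\<omega>, r). S r (Z \<omega>)) \<in> P \<Otimes>\<^sub>M theta \<alpha> \<rightarrow>\<^sub>M M"
    by measurable
  have ind: "(\<lambda>(\<omega>, r). indicator B (S r (Z \<omega>)) :: ennreal) \<in> borel_measurable (P \<Otimes>\<^sub>M theta \<alpha>)"
    if [measurable]: "B \<in> sets M" for B
    using SZ by measurable
  have inner: "(\<lambda>r. indicator B (S r (Z \<omega>)) :: ennreal) \<in> borel_measurable (theta \<alpha>)"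
    if "B \<in> sets M" "\<omega> \<in> space P" for B \<omega>
    using measurable_Pair2[OF ind[OF that(1)] that(2)] by simp
  have outer: "(\<lambda>\<omega>. \<integral>\<^sup>+r. indicator B (S r (Z \<omega>)) \<partial>theta \<alpha>) \<in> borel_measurable P"
    if "B \<in> sets M" for B
    using T.borel_measurable_nn_integral[OF ind[OF that]] by simp
  show ?thesis
  proof (rule emeasure_measure_of[OF orbit_measure_def sets.space_closed])
    show "positive (sets (orbit_measure M S \<alpha> P Z))
      (\<lambda>A. \<integral>\<^sup>+\<omega>. (\<integral>\<^sup>+r. indicator A (S r (Z \<omega>)) \<partial>theta \<alpha>) \<partial>P)"
      by (simp add: positive_def)
    show "A \<in> sets (orbit_measure M S \<alpha> P Z)"
      using A by (simp add: orbit_measure_def)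
    show "countably_additive (sets (orbit_measure M S \<alpha> P Z))
      (\<lambda>A. \<integral>\<^sup>+\<omega>. (\<integral>\<^sup>+r. indicator A (S r (Z \<omega>)) \<partial>theta \<alpha>) \<partial>P)"
    proof (rule countably_additiveI)
      fix B :: "nat \<Rightarrow> 'a set"
      assume "range B \<subseteq> sets (orbit_measure M S \<alpha> P Z)" and disj: "disjoint_family B"
      then have B: "B n \<in> sets M" for n
        by (auto simp: orbit_measure_def)
      have "(\<Sum>n. \<integral>\<^sup>+\<omega>. (\<integral>\<^sup>+r. indicator (B n) (S r (Z \<omega>)) \<partial>theta \<alpha>) \<partial>P) =
        (\<integral>\<^sup>+\<omega>. (\<Sum>n. \<integral>\<^sup>+r. indicator (B n) (S r (Z \<omega>)) \<partial>theta \<alpha>) \<partial>P)"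
        by (rule nn_integral_suminf[symmetric]) (rule outer[OF B])
      also have "\<dots> = (\<integral>\<^sup>+\<omega>. (\<integral>\<^sup>+r. (\<Sum>n. indicator (B n) (S r (Z \<omega>))) \<partial>theta \<alpha>) \<partial>P)"
        by (intro nn_integral_cong nn_integral_suminf[symmetric]) (rule inner[OF B])
      finally show "(\<Sum>n. \<integral>\<^sup>+\<omega>. (\<integral>\<^sup>+r. indicator (B n) (S r (Z \<omega>)) \<partial>theta \<alpha>) \<partial>P) =
        (\<integral>\<^sup>+\<omega>. (\<integral>\<^sup>+r. indicator (\<Union>n. B n) (S r (Z \<omega>)) \<partial>theta \<alpha>) \<partial>P)"
        by (simp add: suminf_indicator[OF disj])
    qed
  qed
qed

lemma gauge_dom_sets:
  assumes "product_gauge M S \<tau>"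
  shows "gauge_dom M \<tau> \<in> sets M"
proof -
  have [measurable]: "\<tau> \<in> M \<rightarrow>\<^sub>M borel" using assms by (simp add: product_gauge_def)
  show ?thesis unfolding gauge_dom_def by measurable
qed

lemma measurable_section_proj:
  fixes S :: "real ^ 'q \<Rightarrow> 'e \<Rightarrow> 'e"
  assumes S: "measurable_action M S" and \<tau>: "product_gauge M S \<tau>"
    and w: "w \<in> gauge_section M \<tau>"
  shows "section_proj M S \<tau> w \<in> M \<rightarrow>\<^sub>M section_space M \<tau>"
proof -
  have \<tau>_meas: "\<tau> \<in> M \<rightarrow>\<^sub>M borel" using \<tau> by (simp add: product_gauge_def)
  note dom = gauge_dom_sets[OF \<tau>]
  have w': "w \<in> space M" using w by (auto simp: gauge_section_def gauge_dom_def)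
  define g where "g x = (if x \<in> gauge_dom M \<tau> then vec_inv (\<tau> x) else 1)" for x
  have g_pos: "g x \<in> pos_orthant" for x
    by (cases "x \<in> gauge_dom M \<tau>") (simp_all add: g_def gauge_dom_def pos_orthant_def vec_inv_def)
  have vi: "(vec_inv :: real ^ 'q \<Rightarrow> _) \<in> borel_measurable borel"
  proof (rule borel_measurable_euclidean_space[THEN iffD2], rule ballI)
    fix b :: "real ^ 'q" assume "b \<in> Basis"
    then obtain i where b: "b = axis i 1"
      by (auto simp: Basis_vec_def)
    have "vec_inv r \<bullet> b = inverse (r $ i)" for r :: "real ^ 'q"
      unfolding b inner_axis vec_inv_def vec_lambda_beta inner_real_def by (rule mult_1_right)
    then show "(\<lambda>r :: real ^ 'q. vec_inv r \<bullet> b) \<in> borel_measurable borel"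
      by simp
  qed
  have "(\<lambda>x. vec_inv (\<tau> x)) \<in> M \<rightarrow>\<^sub>M borel"
    by (rule measurable_compose[OF \<tau>_meas vi])
  then have "g \<in> M \<rightarrow>\<^sub>M borel"
    unfolding g_def by (rule measurable_If_set) (simp_all add: dom)
  then have g: "g \<in> M \<rightarrow>\<^sub>M restrict_space borel pos_orthant"
    by (rule measurable_restrict_space2[rotated]) (simp add: g_pos)
  have "(\<lambda>x. (g x, x)) \<in> M \<rightarrow>\<^sub>M restrict_space borel pos_orthant \<Otimes>\<^sub>M M"
    by (rule measurable_Pair[OF g measurable_ident_sets[OF refl]])
  moreover have "(\<lambda>(r, x). S r x) \<in> restrict_space borel pos_orthant \<Otimes>\<^sub>M M \<rightarrow>\<^sub>M M"
    using S unfolding measurable_action_def by (rule conjunct1)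
  ultimately have "(\<lambda>x. (\<lambda>(r, x). S r x) (g x, x)) \<in> M \<rightarrow>\<^sub>M M"
    by (rule measurable_compose)
  then have Sg: "(\<lambda>x. S (g x) x) \<in> M \<rightarrow>\<^sub>M M"
    by (simp only: prod.case)
  have eq: "section_proj M S \<tau> w = (\<lambda>x. if x \<in> gauge_dom M \<tau> then S (g x) x else w)"
    by (auto simp: section_proj_def g_def)
  have M: "section_proj M S \<tau> w \<in> M \<rightarrow>\<^sub>M M"
    unfolding eq by (rule measurable_If_set[OF Sg]) (simp_all add: dom w')
  have "section_proj M S \<tau> w x \<in> gauge_section M \<tau>" if x: "x \<in> space M" for x
  proof (cases "x \<in> gauge_dom M \<tau>")
    case True
    then have v: "vec_inv (\<tau> x) \<in> pos_orthant"
      by (auto simp: gauge_dom_def pos_orthant_def vec_inv_def)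
    have "\<tau> (S (vec_inv (\<tau> x)) x) = vec_inv (\<tau> x) * \<tau> x"
      using \<tau> v x by (auto simp: product_gauge_def)
    also have "\<dots> = 1"
    proof -
      have "0 < \<tau> x $ i" for i
        using True by (simp add: gauge_dom_def)
      then have "\<tau> x $ i \<noteq> 0" for i
        by (simp add: less_imp_neq[symmetric])
      then show ?thesis by (simp add: vec_eq_iff vec_inv_def)
    qed
    finally show ?thesis
      using True measurable_space[OF M x]
      by (auto simp: section_proj_def gauge_section_def gauge_dom_def)
  qed (use w in \<open>auto simp: section_proj_def\<close>)
  then show ?thesis
    unfolding section_space_def using M by (auto intro!: measurable_restrict_space2)
qed

lemma emeasure_varsigma:
  assumes S: "measurable_action M S" and \<tau>: "product_gauge M S \<tau>"
    and w: "w \<in> gauge_section M \<tau>" and \<nu>: "sets \<nu> = sets M"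
    and D: "D \<in> sets (section_space M \<tau>)"
  shows "emeasure (varsigma M S \<alpha> \<nu> \<tau> w) D =
    (\<integral>\<^sup>+x\<in>gauge_dom M \<tau>. (ennreal (chi \<alpha> (\<tau> x)) * h_weight \<alpha> \<tau> x *
        indicator D (section_proj M S \<tau> w x)) \<partial>\<nu>)"
proof -
  note \<nu>[measurable_cong]
  have [measurable]: "\<tau> \<in> M \<rightarrow>\<^sub>M borel" using \<tau> by (simp add: product_gauge_def)
  note gauge_dom_sets[OF \<tau>, measurable] measurable_section_proj[OF S \<tau> w, measurable]
  let ?f = "\<lambda>x. ennreal (chi \<alpha> (\<tau> x)) * h_weight \<alpha> \<tau> x * indicator (gauge_dom M \<tau>) x"
  have f[measurable]: "?f \<in> borel_measurable \<nu>"
    unfolding h_weight_def by measurable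
  let ?N = "distr (density \<nu> ?f) (section_space M \<tau>) (section_proj M S \<tau> w)"
  have N: "emeasure ?N B = (\<integral>\<^sup>+x\<in>gauge_dom M \<tau>. (ennreal (chi \<alpha> (\<tau> x)) * h_weight \<alpha> \<tau> x *
        indicator B (section_proj M S \<tau> w x)) \<partial>\<nu>)" if [measurable]: "B \<in> sets (section_space M \<tau>)" for B
  proof -
    have "emeasure ?N B = (\<integral>\<^sup>+y. indicator B y \<partial>?N)"
      by simp
    also have "\<dots> = (\<integral>\<^sup>+x. indicator B (section_proj M S \<tau> w x) \<partial>density \<nu> ?f)"
      by (rule nn_integral_distr) measurable
    also have "\<dots> = (\<integral>\<^sup>+x. ?f x * indicator B (section_proj M S \<tau> w x) \<partial>\<nu>)"
      by (rule nn_integral_density) measurable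
    finally show ?thesis by (simp add: ac_simps)
  qed
  have "varsigma M S \<alpha> \<nu> \<tau> w = measure_of (space ?N) (sets ?N) (emeasure ?N)"
    unfolding varsigma_def
    by (simp only: space_distr sets_distr)
       (rule measure_of_eq[OF sets.space_closed], simp add: N sets.sigma_sets_eq)
  then have "varsigma M S \<alpha> \<nu> \<tau> w = ?N"
    by (simp only: measure_of_of_measure)
  then show ?thesis using N[OF D] by simp
qed

end

theory Submission
  imports Defs
begin

text \<open>
  A gauge \<open>\<tau>\<close> turns each point \<open>x\<close> with \<open>\<tau> x > 0\<close> into a pair of polar coordinates: the radius
  \<open>\<tau> x\<close> and the point \<open>\<Pi> x\<close> of the section \<open>{\<tau> = 1}\<close>. In these coordinates the action is a
  translation of the radius. The proof reduces every assertion about a random element \<open>Z\<close> to a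
  single measure on the section,
  \<open>\<rho>\<^sub>Z(D) = E(\<chi>(\<tau> Z) 1{\<Pi> Z \<in> D})\<close>, called \<open>section_measure\<close> below.

  Translating \<open>\<theta>\<close> by \<open>s\<close> multiplies it by \<open>\<chi> s\<close> (\<open>nn_integral_theta_scale\<close>). Replacing \<open>Z\<close> by
  \<open>\<Pi> Z\<close> in an orbit integral therefore costs the factor \<open>\<chi>(\<tau> Z)\<close>, and, as long as \<open>\<tau> Z > 0\<close> almost
  surely, the orbit measure of \<open>Z\<close> is the image of \<open>\<theta> \<otimes> \<rho>\<^sub>Z\<close> under the action
  (\<open>orbit_measure_section_measure\<close>). Conversely, integrating over the slice where \<open>\<tau>\<close> lies in
  \<^term>\<open>C_star\<close> recovers \<open>\<rho>\<close> from the image of \<open>\<theta> \<otimes> \<rho>\<close> (\<open>orbit_measure_section_inject\<close>).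

  The homogeneous measure \<open>\<nu>\<close> is itself such an image, with \<open>\<rho> = \<sigma>\<close> the measure \<open>varsigma\<close>: it is
  the orbit measure of the identity under the weighted measure \<open>h \<nu>\<close>
  (\<open>orbit_measure_weighted_nu\<close>). This is a Tonelli argument, in which the average of the weight
  \<open>h\<close> over each orbit with respect to Haar measure is \<open>1\<close>, homogeneity moves the action off \<open>\<nu>\<close>,
  and inversion invariance of Haar measure restores the orbit integral.

  Every representer satisfies \<open>\<tau> Z > 0\<close> almost surely (\<open>AE_dom_of_orbit_measure\<close>), and a random element
  with this property represents \<open>\<nu>\<close> if and only if \<open>\<rho>\<^sub>Z = \<sigma>\<close> (\<open>orbit_measure_eq_iff\<close>). The rest is
  read off from this criterion. The total mass of \<open>\<rho>\<^sub>Z\<close> is \<open>E \<chi>(\<tau> Z)\<close>. If radius and section point are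
  independent, then \<open>\<rho>\<^sub>Z\<close> is \<open>E \<chi>(\<tau> Z)\<close> times the law of \<open>\<Pi> Z\<close>. An infinite factor is then
  impossible: \<open>\<sigma>\<close> would take only the values \<open>0\<close> and \<open>\<infinity>\<close>, against the \<open>\<sigma>\<close>-finiteness of \<open>\<nu>\<close>
  (\<open>varsigma_neq_infinite_multiple\<close>). If the mass \<open>s\<close> of \<open>\<sigma>\<close> is finite, a random element whose
  gauge is constantly \<open>a\<close>, where \<open>\<chi> a = s\<close>, represents \<open>\<nu>\<close> exactly when its section point has law
  \<open>\<sigma> / s\<close>. Tilting the probability by \<open>\<chi>(\<tau> Z) / s\<close> gives \<open>\<Pi> Z\<close> that law.
\<close>

section \<open>The group of positive vectors and its measures\<close>

lemma mult_in_pos_orthant [simp]: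
  "r \<in> pos_orthant \<Longrightarrow> s \<in> pos_orthant \<Longrightarrow> r * s \<in> pos_orthant"
  by (simp add: pos_orthant_def)

lemma vec_inv_in_pos_orthant [simp]: "r \<in> pos_orthant \<Longrightarrow> vec_inv r \<in> pos_orthant"
  by (simp add: pos_orthant_def vec_inv_def)

lemma mult_in_pos_orthant_iff:
  "r \<in> pos_orthant \<Longrightarrow> r * s \<in> pos_orthant \<longleftrightarrow> s \<in> pos_orthant"
  by (auto simp: pos_orthant_def zero_less_mult_iff dest: order_less_asym)

lemma vec_inv_mult: "r \<in> pos_orthant \<Longrightarrow> vec_inv r * r = 1"
  by (simp add: vec_eq_iff pos_orthant_def vec_inv_def order_less_imp_not_eq2)

lemma mult_vec_inv: "r \<in> pos_orthant \<Longrightarrow> r * vec_inv r = 1"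
  using vec_inv_mult[of r] by (simp add: mult.commute)

lemma vec_inv_vec_inv [simp]: "vec_inv (vec_inv r) = r"
  by (simp add: vec_inv_def vec_eq_iff)

lemma vec_inv_one [simp]: "vec_inv 1 = 1"
  by (simp add: vec_inv_def vec_eq_iff)

lemma vec_inv_mult_distrib: "vec_inv (r * s) = vec_inv r * vec_inv s"
  by (simp add: vec_inv_def vec_eq_iff)

lemma C_star_subset_pos_orthant: "C_star \<subseteq> pos_orthant"
  by (force simp: C_star_def pos_orthant_def intro: order_less_trans[OF zero_less_one])

lemma chi_pos: "r \<in> pos_orthant \<Longrightarrow> 0 < chi \<alpha> r"
  unfolding chi_def pos_orthant_def
  by (intro prod_pos) (simp add: order_less_imp_not_eq2)

lemma chi_nonneg: "0 \<le> chi \<alpha> r"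
  by (simp add: chi_def prod_nonneg)

lemma chi_mult:
  "r \<in> pos_orthant \<Longrightarrow> s \<in> pos_orthant \<Longrightarrow> chi \<alpha> (r * s) = chi \<alpha> r * chi \<alpha> s"
  by (simp add: chi_def pos_orthant_def powr_mult less_imp_le prod.distrib)

lemma chi_one [simp]: "chi \<alpha> 1 = 1"
  by (simp add: chi_def)

lemma chi_vec_inv: "r \<in> pos_orthant \<Longrightarrow> chi \<alpha> (vec_inv r) = inverse (chi \<alpha> r)"
  using chi_mult[of "vec_inv r" r \<alpha>] chi_pos[of r \<alpha>]
  by (simp add: vec_inv_mult nonzero_eq_divide_eq inverse_eq_divide)

lemma borel_measurable_vec_mult [measurable (raw)]:
  fixes f g :: "'a \<Rightarrow> real ^ 'q"
  assumes [measurable]: "f \<in> borel_measurable M" "g \<in> borel_measurable M"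
  shows "(\<lambda>x. f x * g x) \<in> borel_measurable M"
proof (rule borel_measurable_euclidean_space[THEN iffD2], rule ballI)
  fix b :: "real ^ 'q" assume "b \<in> Basis"
  then obtain i where b: "b = axis i 1"
    by (auto simp: Basis_vec_def)
  show "(\<lambda>x. (f x * g x) \<bullet> b) \<in> borel_measurable M"
    unfolding b inner_axis vector_mult_component by simp
qed

lemma borel_measurable_vec_inv [measurable (raw)]:
  fixes f :: "'a \<Rightarrow> real ^ 'q"
  assumes [measurable]: "f \<in> borel_measurable M"
  shows "(\<lambda>x. vec_inv (f x)) \<in> borel_measurable M"
proof (rule borel_measurable_euclidean_space[THEN iffD2], rule ballI)
  fix b :: "real ^ 'q" assume "b \<in> Basis"
  then obtain i where b: "b = axis i 1"
    by (auto simp: Basis_vec_def)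
  show "(\<lambda>x. vec_inv (f x) \<bullet> b) \<in> borel_measurable M"
    unfolding b inner_axis vec_inv_def vec_lambda_beta by simp
qed

lemma prod_Basis_vec:
  "(\<Prod>j\<in>(Basis :: (real ^ 'q) set). f j) = (\<Prod>i\<in>UNIV. f (axis i 1))"
proof -
  have B: "(Basis :: (real ^ 'q) set) = (\<lambda>i :: 'q. axis i (1 :: real)) ` UNIV"
    by (auto simp: Basis_vec_def)
  show ?thesis
    unfolding B by (subst prod.reindex) (auto simp: inj_on_def axis_eq_axis)
qed

text \<open>
  Coordinatewise multiplication by \<open>s\<close> is the diagonal linear map with determinant \<open>\<Prod>i. s $ i\<close>.
\<close>

lemma nn_integral_lborel_vec_scale:
  fixes s :: "real ^ 'q"
  assumes s: "s \<in> pos_orthant" and g [measurable]: "g \<in> borel_measurable borel"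
  shows "(\<integral>\<^sup>+x. g x \<partial>lborel) = ennreal (\<Prod>i\<in>UNIV. s $ i) * (\<integral>\<^sup>+x. g (x * s) \<partial>lborel)"
proof -
  have T: "(\<lambda>x. 0 + (\<Sum>j\<in>Basis. ((s \<bullet> j) * (x \<bullet> j)) *\<^sub>R j)) = (\<lambda>x. x * s)"
  proof
    fix x :: "real ^ 'q"
    have "(s \<bullet> j) * (x \<bullet> j) = (x * s) \<bullet> j" if "j \<in> Basis" for j
    proof -
      obtain i where "j = axis i 1" using \<open>j \<in> Basis\<close> by (auto simp: Basis_vec_def)
      then show ?thesis by (simp add: inner_axis mult.commute)
    qed
    then show "0 + (\<Sum>j\<in>Basis. ((s \<bullet> j) * (x \<bullet> j)) *\<^sub>R j) = x * s"
      by (simp add: euclidean_representation)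
  qed
  have "s \<bullet> j \<noteq> 0" if "j \<in> Basis" for j
    using s \<open>j \<in> Basis\<close>
    by (auto simp: Basis_vec_def inner_axis pos_orthant_def order_less_imp_not_eq2)
  then have "(lborel :: (real ^ 'q) measure) = density (distr lborel borel (\<lambda>x. x * s)) (\<lambda>_. (\<Prod>j\<in>Basis. \<bar>s \<bullet> j\<bar>))"
    using lborel_affine_euclidean[of "\<lambda>j. s \<bullet> j" 0] unfolding T by simp
  also have "(\<Prod>j\<in>Basis. \<bar>s \<bullet> j\<bar>) = (\<Prod>i\<in>UNIV. s $ i)"
    using s by (simp add: prod_Basis_vec inner_axis pos_orthant_def abs_of_pos)
  finally have L: "(lborel :: (real ^ 'q) measure) =
      density (distr lborel borel (\<lambda>x. x * s)) (\<lambda>_. ennreal (\<Prod>i\<in>UNIV. s $ i))" .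
  show ?thesis
    by (subst L, subst nn_integral_density)
      (simp_all add: nn_integral_distr nn_integral_cmult)
qed

lemma space_theta [simp]: "space (theta \<alpha>) = pos_orthant"
  by (simp add: theta_def space_restrict_space)

lemma nn_integral_theta:
  assumes g: "g \<in> borel_measurable (theta (\<alpha> :: real ^ 'q))"
  shows "(\<integral>\<^sup>+r. g r \<partial>theta \<alpha>) =
    (\<integral>\<^sup>+r. ennreal (\<Prod>i\<in>UNIV. \<alpha> $ i * (r $ i) powr (- (\<alpha> $ i) - 1)) *
      (g r * indicator pos_orthant r) \<partial>lborel)"
proof -
  have "g \<in> borel_measurable (restrict_space lborel pos_orthant)"
    using g by (simp add: sets_theta cong: measurable_cong_sets sets_restrict_space_cong)
  then show ?thesis
    unfolding theta_def
    by (subst nn_integral_density)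
       (auto simp: nn_integral_restrict_space ac_simps intro!: measurable_restrict_space1)
qed

lemma borel_measurable_theta_iff:
  "g \<in> borel_measurable (theta \<alpha>) \<longleftrightarrow> (\<lambda>r. g r * indicator pos_orthant r :: ennreal) \<in> borel_measurable borel"
proof -
  have "g \<in> borel_measurable (theta \<alpha>) \<longleftrightarrow> g \<in> borel_measurable (restrict_space borel pos_orthant)"
    by (simp add: sets_theta cong: measurable_cong_sets)
  also have "\<dots> \<longleftrightarrow> (\<lambda>r. g r * indicator pos_orthant r) \<in> borel_measurable borel"
    by (rule borel_measurable_restrict_space_iff_ennreal) simp
  finally show ?thesis .
qed

text \<open>
  The density of \<^term>\<open>theta \<alpha>\<close> is homogeneous of degree \<open>-\<alpha> $ i - 1\<close> in the \<open>i\<close>-th coordinate, and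
  the change of variables contributes one further degree in each coordinate. The remaining factor is
  \<^term>\<open>chi \<alpha> s\<close>.
\<close>

lemma nn_integral_theta_scale:
  assumes s: "s \<in> pos_orthant" and g: "g \<in> borel_measurable (theta \<alpha>)"
  shows "(\<integral>\<^sup>+r. g (r * s) \<partial>theta \<alpha>) = ennreal (chi \<alpha> s) * (\<integral>\<^sup>+r. g r \<partial>theta \<alpha>)"
proof -
  let ?k = "\<lambda>r. \<Prod>i\<in>UNIV. \<alpha> $ i * (r $ i) powr (- (\<alpha> $ i) - 1)"
  define h where "h r = g r * indicator pos_orthant r" for r
  have h [measurable]: "h \<in> borel_measurable borel"
    using g unfolding h_def borel_measurable_theta_iff .
  have s0: "0 < s $ i" for i using s by (simp add: pos_orthant_def)
  have gs: "g (r * s) * indicator pos_orthant r = h (r * s)" for r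
    using mult_in_pos_orthant_iff[OF s, of r] by (simp add: h_def indicator_def mult.commute)
  have gs_meas: "(\<lambda>r. g (r * s)) \<in> borel_measurable (theta \<alpha>)"
    unfolding borel_measurable_theta_iff gs by measurable
  define p where "p = (\<Prod>i\<in>UNIV. (s $ i) powr (- (\<alpha> $ i) - 1))"
  define u where "u = (\<Prod>i\<in>UNIV. s $ i)"
  have p0: "0 \<le> p" and u0: "0 \<le> u" using s0 by (simp_all add: p_def u_def prod_nonneg less_imp_le)
  have k: "ennreal (?k (r * s)) * h (r * s) = ennreal p * (ennreal (?k r) * h (r * s))" for r
  proof (cases "r \<in> pos_orthant")
    case True
    then have "?k (r * s) = p * ?k r"
      using s0 by (simp add: p_def pos_orthant_def powr_mult less_imp_le prod.distrib[symmetric] ac_simps)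
    then show ?thesis using p0 by (simp add: ennreal_mult' mult.assoc)
  next
    case False
    then show ?thesis using gs[of r] by simp
  qed
  have cup: "chi \<alpha> s * u * p = 1"
  proof -
    have "(s $ i) powr (\<alpha> $ i) * s $ i * (s $ i) powr (- (\<alpha> $ i) - 1) = 1" for i
      using s0[of i] by (simp add: powr_diff powr_minus field_simps)
    then show ?thesis
      unfolding chi_def u_def p_def prod.distrib[symmetric] by simp
  qed
  have "(\<integral>\<^sup>+r. g r \<partial>theta \<alpha>) = (\<integral>\<^sup>+r. ennreal (?k r) * h r \<partial>lborel)"
    by (simp add: nn_integral_theta[OF g] h_def)
  also have "\<dots> = ennreal u * (\<integral>\<^sup>+r. ennreal (?k (r * s)) * h (r * s) \<partial>lborel)"
    unfolding u_def by (rule nn_integral_lborel_vec_scale[OF s]) measurable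
  also have "\<dots> = ennreal u * (ennreal p * (\<integral>\<^sup>+r. ennreal (?k r) * h (r * s) \<partial>lborel))"
    unfolding k by (subst nn_integral_cmult) simp_all
  also have "(\<integral>\<^sup>+r. ennreal (?k r) * h (r * s) \<partial>lborel) = (\<integral>\<^sup>+r. g (r * s) \<partial>theta \<alpha>)"
    by (simp only: nn_integral_theta[OF gs_meas] gs)
  finally have "ennreal (chi \<alpha> s) * (\<integral>\<^sup>+r. g r \<partial>theta \<alpha>) =
      ennreal (chi \<alpha> s * u * p) * (\<integral>\<^sup>+r. g (r * s) \<partial>theta \<alpha>)"
    using u0 p0 chi_nonneg[of \<alpha> s] by (simp add: ennreal_mult mult.assoc)
  then show ?thesis by (simp add: cup)
qed

lemma sets_haar: "sets (haar \<alpha>) = sets (theta \<alpha>)"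
  by (simp add: haar_def theta_def)

text \<open>
  This relation transfers the behaviour of \<^term>\<open>theta \<alpha>\<close> under scaling to \<^term>\<open>haar \<alpha>\<close>.
\<close>

lemma haar_eq_density_theta:
  assumes \<alpha>: "\<alpha> \<in> pos_orthant"
  shows "haar \<alpha> = density (theta \<alpha>) (\<lambda>r. ennreal (chi \<alpha> r))"
proof -
  have "haar \<alpha> = density (restrict_space lborel pos_orthant)
      (\<lambda>r. ennreal (\<Prod>i\<in>UNIV. \<alpha> $ i * (r $ i) powr (- (\<alpha> $ i) - 1)) * ennreal (chi \<alpha> r))"
    unfolding haar_def
  proof (rule density_cong)
    have "ennreal (\<Prod>i\<in>UNIV. \<alpha> $ i / r $ i) =
        ennreal (\<Prod>i\<in>UNIV. \<alpha> $ i * r $ i powr (- \<alpha> $ i - 1)) * ennreal (chi \<alpha> r)"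
      if r: "r \<in> pos_orthant" for r
    proof -
      have "\<alpha> $ i * r $ i powr (- \<alpha> $ i - 1) * r $ i powr (\<alpha> $ i) = \<alpha> $ i / r $ i" for i
      proof -
        have "0 < r $ i" using r by (simp add: pos_orthant_def)
        then show ?thesis by (simp add: powr_diff powr_minus field_simps)
      qed
      then show ?thesis
        by (simp add: chi_nonneg flip: ennreal_mult'' prod.distrib add: chi_def prod_nonneg)
    qed
    then show "AE r in restrict_space lborel pos_orthant. ennreal (\<Prod>i\<in>UNIV. \<alpha> $ i / r $ i) =
        ennreal (\<Prod>i\<in>UNIV. \<alpha> $ i * r $ i powr (- \<alpha> $ i - 1)) * ennreal (chi \<alpha> r)"
      by (intro AE_I2) (simp add: space_restrict_space)
  qed (intro measurable_restrict_space1; simp)+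
  also have "\<dots> = density (theta \<alpha>) (\<lambda>r. ennreal (chi \<alpha> r))"
    unfolding theta_def
    by (rule density_density_eq[symmetric]) (intro measurable_restrict_space1; simp)+
  finally show ?thesis .
qed

lemma sigma_finite_haar:
  assumes "\<alpha> \<in> pos_orthant"
  shows "sigma_finite_measure (haar \<alpha>)"
proof -
  interpret T: sigma_finite_measure "theta \<alpha>" by (rule sigma_finite_theta)
  have "(\<lambda>r. ennreal (chi \<alpha> r)) \<in> borel_measurable (theta \<alpha>)"
    by (simp add: borel_measurable_theta_iff)
  from T.sigma_finite_iff_density_finite[OF this] show ?thesis
    by (simp add: haar_eq_density_theta[OF assms])
qed

lemma nn_integral_haar:
  assumes "\<alpha> \<in> pos_orthant" and "g \<in> borel_measurable (theta \<alpha>)"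
  shows "(\<integral>\<^sup>+r. g r \<partial>haar \<alpha>) = (\<integral>\<^sup>+r. ennreal (chi \<alpha> r) * g r \<partial>theta \<alpha>)"
  unfolding haar_eq_density_theta[OF assms(1)]
  by (rule nn_integral_density) (use assms(2) in \<open>simp_all add: borel_measurable_theta_iff\<close>)

text \<open>
  The factor \<^term>\<open>chi \<alpha> s\<close> produced by \<^term>\<open>theta \<alpha>\<close> cancels against the multiplicativity of the
  density \<^term>\<open>chi \<alpha>\<close>.
\<close>

lemma nn_integral_haar_scale:
  assumes \<alpha>: "\<alpha> \<in> pos_orthant" and s: "s \<in> pos_orthant" and g: "g \<in> borel_measurable (theta \<alpha>)"
  shows "(\<integral>\<^sup>+r. g (r * s) \<partial>haar \<alpha>) = (\<integral>\<^sup>+r. g r \<partial>haar \<alpha>)"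
proof -
  note sets_theta [measurable_cong] and g [measurable]
  have [measurable]: "(\<lambda>r. ennreal (chi \<alpha> r)) \<in> borel_measurable (theta \<alpha>)"
    by (simp add: borel_measurable_theta_iff)
  have [measurable]: "(\<lambda>r. r * s) \<in> theta \<alpha> \<rightarrow>\<^sub>M theta \<alpha>"
    unfolding measurable_cong_sets[OF sets_theta sets_theta]
    by (rule measurable_restrict_space3) (simp_all add: s)
  have gs: "(\<lambda>r. g (r * s)) \<in> borel_measurable (theta \<alpha>)"
    by measurable
  have c: "ennreal (chi \<alpha> s) * ennreal (inverse (chi \<alpha> s)) = 1"
    using chi_pos[OF s, of \<alpha>] by (simp flip: ennreal_mult)
  have "(\<integral>\<^sup>+r. g (r * s) \<partial>haar \<alpha>) = (\<integral>\<^sup>+r. ennreal (chi \<alpha> r) * g (r * s) \<partial>theta \<alpha>)"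
    by (rule nn_integral_haar[OF \<alpha> gs])
  also have "\<dots> = (\<integral>\<^sup>+r. ennreal (inverse (chi \<alpha> s)) * (ennreal (chi \<alpha> (r * s)) * g (r * s)) \<partial>theta \<alpha>)"
  proof (rule nn_integral_cong)
    fix r assume "r \<in> space (theta \<alpha>)"
    then have "ennreal (chi \<alpha> (r * s)) = ennreal (chi \<alpha> s) * ennreal (chi \<alpha> r)"
      by (simp add: chi_mult s ennreal_mult chi_nonneg mult.commute)
    then show "ennreal (chi \<alpha> r) * g (r * s) =
        ennreal (inverse (chi \<alpha> s)) * (ennreal (chi \<alpha> (r * s)) * g (r * s))"
      using c by (simp add: mult.assoc[symmetric] mult.commute[of "ennreal (inverse (chi \<alpha> s))"])
  qed
  also have "\<dots> = ennreal (inverse (chi \<alpha> s)) * (\<integral>\<^sup>+r. (ennreal (chi \<alpha> (r * s)) * g (r * s)) \<partial>theta \<alpha>)"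
    by (rule nn_integral_cmult) measurable
  also have "\<dots> = ennreal (inverse (chi \<alpha> s)) * (ennreal (chi \<alpha> s) * (\<integral>\<^sup>+r. ennreal (chi \<alpha> r) * g r \<partial>theta \<alpha>))"
    by (subst nn_integral_theta_scale[OF s, of "\<lambda>r. ennreal (chi \<alpha> r) * g r" \<alpha>]) measurable
  also have "\<dots> = (\<integral>\<^sup>+r. g r \<partial>haar \<alpha>)"
    using c by (simp add: nn_integral_haar[OF \<alpha> g] mult.assoc[symmetric] mult.commute)
  finally show ?thesis .
qed

text \<open>
  On \<^term>\<open>C_star\<close> the densities are positive and bounded, and the set lies between the open box
  and the closed box with corners \<open>1\<close> and \<open>2\<close>. These bounds allow division by both masses.
\<close>

lemma emeasure_C_star:
  fixes \<alpha> :: "real ^ 'q"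
  assumes \<alpha>: "\<alpha> \<in> pos_orthant"
  shows emeasure_theta_C_star_pos: "0 < emeasure (theta \<alpha>) C_star"
    and emeasure_theta_C_star_finite: "emeasure (theta \<alpha>) C_star < \<infinity>"
    and d_const_pos: "0 < d_const \<alpha>"
    and d_const_finite: "d_const \<alpha> < \<infinity>"
proof -
  have \<alpha>0: "0 < \<alpha> $ i" for i using \<alpha> by (simp add: pos_orthant_def)
  let ?k = "\<lambda>r. \<Prod>i\<in>UNIV. \<alpha> $ i * (r $ i) powr (- (\<alpha> $ i) - 1)"
  have C [measurable]: "C_star \<in> sets (theta \<alpha>)" "C_star \<in> sets (haar \<alpha>)"
    using C_star_subset_pos_orthant
    by (simp_all add: sets_haar sets_theta sets_restrict_space_iff)
  have indC: "indicator C_star r * indicator pos_orthant r = (indicator C_star r :: ennreal)" for r :: "real ^ 'q"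
    using C_star_subset_pos_orthant by (auto simp: indicator_def)
  have \<theta>: "emeasure (theta \<alpha>) C_star = (\<integral>\<^sup>+r. ennreal (?k r) * indicator C_star r \<partial>lborel)"
    using nn_integral_theta[of "indicator C_star" \<alpha>] C by (simp add: indC)
  have d: "d_const \<alpha> = (\<integral>\<^sup>+r. ennreal (chi \<alpha> r) * indicator C_star r \<partial>theta \<alpha>)"
    unfolding d_const_def haar_eq_density_theta[OF \<alpha>]
    by (subst emeasure_density) (simp_all add: C borel_measurable_theta_iff)
  show fin: "emeasure (theta \<alpha>) C_star < \<infinity>"
  proof -
    have "emeasure (theta \<alpha>) C_star \<le> (\<integral>\<^sup>+r. ennreal (\<Prod>i\<in>UNIV. \<alpha> $ i) * indicator (cbox 1 (2 :: real ^ 'q)) r \<partial>lborel)"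
      unfolding \<theta>
    proof (intro nn_integral_mono)
      fix r :: "real ^ 'q"
      have "?k r \<le> (\<Prod>i\<in>UNIV. \<alpha> $ i)" "r \<in> cbox 1 2" if r: "r \<in> C_star"
      proof -
        have "\<alpha> $ i * (r $ i) powr (- (\<alpha> $ i) - 1) \<le> \<alpha> $ i" for i
        proof -
          have "(r $ i) powr (- (\<alpha> $ i) - 1) \<le> (r $ i) powr 0"
            using r \<alpha>0[of i] by (intro powr_mono) (auto simp: C_star_def less_imp_le)
          also have "\<dots> \<le> 1" by simp
          finally show ?thesis using \<alpha>0[of i] by (simp add: mult_left_le)
        qed
        then show "?k r \<le> (\<Prod>i\<in>UNIV. \<alpha> $ i)"
          by (intro prod_mono) (simp add: \<alpha>0 less_imp_le)
        show "r \<in> cbox 1 2"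
          using r by (auto simp: C_star_def mem_box_cart less_imp_le)
      qed
      then show "ennreal (?k r) * indicator C_star r \<le> ennreal (\<Prod>i\<in>UNIV. \<alpha> $ i) * indicator (cbox 1 (2 :: real ^ 'q)) r"
        by (auto simp: indicator_def intro!: ennreal_leI)
    qed
    also have "\<dots> < \<infinity>"
      by (simp add: nn_integral_cmult_indicator ennreal_mult_less_top emeasure_lborel_cbox_eq)
    finally show ?thesis .
  qed
  show pos: "0 < emeasure (theta \<alpha>) C_star"
  proof (rule ccontr)
    assume "\<not> ?thesis"
    then have "(\<integral>\<^sup>+r. ennreal (?k r) * indicator C_star r \<partial>lborel) = 0"
      by (simp add: \<theta>)
    then have "AE r in lborel. ennreal (?k r) * indicator C_star r = 0"
      by (subst (asm) nn_integral_0_iff_AE) measurable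
    then have "AE r in lborel. r \<notin> box 1 (2 :: real ^ 'q)"
    proof (rule AE_mp, intro AE_I2 impI notI)
      fix r :: "real ^ 'q"
      assume z: "ennreal (?k r) * indicator C_star r = 0" and "r \<in> box 1 2"
      then have r: "1 < r $ i" "r $ i < 2" for i by (auto simp: mem_box_cart)
      have "0 < ?k r"
      proof (intro prod_pos mult_pos_pos \<alpha>0)
        fix i show "0 < r $ i powr (- \<alpha> $ i - 1)" using r(1)[of i] by simp
      qed
      then have "0 < ennreal (?k r)" by (rule ennreal_less_zero_iff[THEN iffD2])
      moreover have "r \<in> C_star" using r by (auto simp: C_star_def less_imp_le)
      ultimately show False using z by (simp only: indicator_simps mult_1_right less_irrefl)
    qed
    then have "emeasure lborel (box 1 (2 :: real ^ 'q)) = 0"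
      by (subst (asm) AE_iff_measurable[OF _ refl]) auto
    moreover have "emeasure lborel (box 1 (2 :: real ^ 'q)) = 1"
    proof -
      have "(1 :: real ^ 'q) \<bullet> b \<le> 2 \<bullet> b" "(2 - 1 :: real ^ 'q) \<bullet> b = 1" if "b \<in> Basis" for b
        using that by (auto simp: Basis_vec_def inner_axis)
      then show ?thesis by (simp add: emeasure_lborel_box_eq)
    qed
    ultimately show False by simp
  qed
  have chi_C: "1 \<le> chi \<alpha> r \<and> chi \<alpha> r \<le> chi \<alpha> 2" if r: "r \<in> C_star" for r
  proof
    have r': "1 \<le> r $ i" "r $ i \<le> 2" for i using r by (simp_all add: C_star_def less_imp_le)
    show "1 \<le> chi \<alpha> r"
      unfolding chi_def by (intro prod_ge_1 ge_one_powr_ge_zero) (simp_all add: r' \<alpha>0 less_imp_le)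
    show "chi \<alpha> r \<le> chi \<alpha> 2"
      unfolding chi_def
      by (intro prod_mono conjI powr_mono2) (simp_all add: r' \<alpha>0 less_imp_le order_trans[OF zero_le_one])
  qed
  have "emeasure (theta \<alpha>) C_star = (\<integral>\<^sup>+r. indicator C_star r \<partial>theta \<alpha>)" by simp
  also have "\<dots> \<le> d_const \<alpha>"
    unfolding d using chi_C
    by (intro nn_integral_mono) (auto simp: indicator_def)
  finally show "0 < d_const \<alpha>" using pos by simp
  have "d_const \<alpha> \<le> (\<integral>\<^sup>+r. ennreal (chi \<alpha> 2) * indicator C_star r \<partial>theta \<alpha>)"
    unfolding d using chi_C
    by (intro nn_integral_mono) (auto simp: indicator_def intro!: ennreal_leI)
  also have "\<dots> < \<infinity>"
    using fin by (simp add: nn_integral_cmult_indicator ennreal_mult_less_top)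
  finally show "d_const \<alpha> < \<infinity>" .
qed

text \<open>
  Inversion invariance follows from translation invariance, as in every commutative group. Multiply
  by the finite positive mass of \<^term>\<open>C_star\<close>, written as an integral over \<open>s\<close>; translate \<open>r\<close> by
  \<open>s\<close>, exchange the integrals, translate \<open>s\<close> by \<open>r\<close>, and exchange them again.
\<close>

lemma nn_integral_haar_inverse:
  fixes \<alpha> :: "real ^ 'q"
  assumes \<alpha>: "\<alpha> \<in> pos_orthant" and g: "g \<in> borel_measurable (theta \<alpha>)"
  shows "(\<integral>\<^sup>+r. g (vec_inv r) \<partial>haar \<alpha>) = (\<integral>\<^sup>+r. g r \<partial>haar \<alpha>)"
proof -
  interpret m: sigma_finite_measure "haar \<alpha>" by (rule sigma_finite_haar[OF \<alpha>])
  interpret mm: pair_sigma_finite "haar \<alpha>" "haar \<alpha>" ..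
  have sp: "space (haar \<alpha>) = pos_orthant" using sets_eq_imp_space_eq[OF sets_haar] by simp
  have sets: "sets (haar \<alpha>) = sets (restrict_space borel pos_orthant)"
    by (simp add: sets_haar sets_theta)
  note sets [measurable_cong]
  have g' [measurable]: "g \<in> borel_measurable (haar \<alpha>)"
    using g by (simp add: sets_haar cong: measurable_cong_sets)
  have b [measurable]: "(\<lambda>r. r) \<in> haar \<alpha> \<rightarrow>\<^sub>M borel"
    unfolding measurable_cong_sets[OF sets refl] by (rule measurable_restrict_space1) simp
  have C [measurable]: "C_star \<in> sets (haar \<alpha>)"
    using C_star_subset_pos_orthant by (simp add: sets sets_restrict_space_iff)
  have inv [measurable]: "vec_inv \<in> haar \<alpha> \<rightarrow>\<^sub>M haar \<alpha>"
    unfolding measurable_cong_sets[OF sets sets]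
    by (rule measurable_restrict_space3) (simp_all)
  have mult [measurable]: "(\<lambda>(r, s). r * s) \<in> haar \<alpha> \<Otimes>\<^sub>M haar \<alpha> \<rightarrow>\<^sub>M haar \<alpha>"
  proof -
    have "(\<lambda>(r, s). r * s) \<in> haar \<alpha> \<Otimes>\<^sub>M haar \<alpha> \<rightarrow>\<^sub>M restrict_space borel pos_orthant"
      by (rule measurable_restrict_space2) (auto simp: space_pair_measure sp)
    then show ?thesis by (simp add: sets cong: measurable_cong_sets)
  qed
  let ?h = "indicator C_star :: real ^ 'q \<Rightarrow> ennreal"
  have h: "?h \<in> borel_measurable (theta \<alpha>)" using C by (simp add: sets_haar)
  have mult1: "(\<lambda>r. r * s) \<in> haar \<alpha> \<rightarrow>\<^sub>M haar \<alpha>" if "s \<in> pos_orthant" for s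
    using measurable_Pair1[OF mult, of s] that by (simp add: sp)
  have mult2: "(\<lambda>r. s * r) \<in> haar \<alpha> \<rightarrow>\<^sub>M haar \<alpha>" if "s \<in> pos_orthant" for s
    using mult1[OF that] by (simp add: mult.commute)
  \<comment> \<open>The function \<open>?h\<close> only serves to bring in a second variable; its integral is cancelled at the end.\<close>
  have "(\<integral>\<^sup>+r. g (vec_inv r) \<partial>haar \<alpha>) * d_const \<alpha> =
      (\<integral>\<^sup>+s. (\<integral>\<^sup>+r. ?h s * g (vec_inv r) \<partial>haar \<alpha>) \<partial>haar \<alpha>)"
    by (simp add: nn_integral_cmult nn_integral_multc d_const_def mult.commute)
  also have "\<dots> = (\<integral>\<^sup>+s. (\<integral>\<^sup>+r. ?h s * g (vec_inv r * s) \<partial>haar \<alpha>) \<partial>haar \<alpha>)"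
  proof (rule nn_integral_cong)
    fix s assume "s \<in> space (haar \<alpha>)"
    then have s: "s \<in> pos_orthant" by (simp add: sp)
    have gm: "(\<lambda>r. g (vec_inv r * s)) \<in> borel_measurable (haar \<alpha>)"
      using mult1[OF s] by measurable
    have "(\<integral>\<^sup>+r. g (vec_inv r * s) \<partial>haar \<alpha>) = (\<integral>\<^sup>+r. g (vec_inv (r * vec_inv s)) \<partial>haar \<alpha>)"
      by (simp add: vec_inv_mult_distrib)
    also have "\<dots> = (\<integral>\<^sup>+r. g (vec_inv r) \<partial>haar \<alpha>)"
      by (rule nn_integral_haar_scale[OF \<alpha>, of _ "\<lambda>r. g (vec_inv r)"])
        (use s in \<open>simp_all flip: measurable_cong_sets[OF sets_haar refl]\<close>)
    finally show "(\<integral>\<^sup>+r. ?h s * g (vec_inv r) \<partial>haar \<alpha>) = (\<integral>\<^sup>+r. ?h s * g (vec_inv r * s) \<partial>haar \<alpha>)"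
      using gm by (simp add: nn_integral_cmult)
  qed
  also have "\<dots> = (\<integral>\<^sup>+r. (\<integral>\<^sup>+s. ?h s * g (vec_inv r * s) \<partial>haar \<alpha>) \<partial>haar \<alpha>)"
    by (rule mm.Fubini') measurable
  also have "\<dots> = (\<integral>\<^sup>+r. (\<integral>\<^sup>+s. ?h (s * r) * g s \<partial>haar \<alpha>) \<partial>haar \<alpha>)"
  proof (rule nn_integral_cong)
    fix r assume "r \<in> space (haar \<alpha>)"
    then have r: "r \<in> pos_orthant" by (simp add: sp)
    have "(\<lambda>s. ?h s * g (vec_inv r * s)) \<in> borel_measurable (haar \<alpha>)"
      using mult2[OF vec_inv_in_pos_orthant[OF r]] by measurable
    then have "(\<lambda>s. ?h s * g (vec_inv r * s)) \<in> borel_measurable (theta \<alpha>)"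
      by (simp flip: measurable_cong_sets[OF sets_haar refl])
    from nn_integral_haar_scale[OF \<alpha> r this]
    show "(\<integral>\<^sup>+s. ?h s * g (vec_inv r * s) \<partial>haar \<alpha>) = (\<integral>\<^sup>+s. ?h (s * r) * g s \<partial>haar \<alpha>)"
      by (simp add: mult.left_commute[of "vec_inv r"] vec_inv_mult[OF r])
  qed
  also have "\<dots> = (\<integral>\<^sup>+s. (\<integral>\<^sup>+r. ?h (s * r) * g s \<partial>haar \<alpha>) \<partial>haar \<alpha>)"
    by (rule mm.Fubini') measurable
  also have "\<dots> = (\<integral>\<^sup>+s. g s * d_const \<alpha> \<partial>haar \<alpha>)"
  proof (rule nn_integral_cong)
    fix s assume "s \<in> space (haar \<alpha>)"
    then have s: "s \<in> pos_orthant" by (simp add: sp)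
    have "(\<lambda>r. ?h (s * r)) \<in> borel_measurable (haar \<alpha>)"
      using mult2[OF s] by measurable
    then have "(\<integral>\<^sup>+r. ?h (s * r) * g s \<partial>haar \<alpha>) = (\<integral>\<^sup>+r. ?h (s * r) \<partial>haar \<alpha>) * g s"
      by (rule nn_integral_multc)
    also have "(\<integral>\<^sup>+r. ?h (s * r) \<partial>haar \<alpha>) = d_const \<alpha>"
      using nn_integral_haar_scale[OF \<alpha> s h] by (simp add: d_const_def mult.commute)
    finally show "(\<integral>\<^sup>+r. ?h (s * r) * g s \<partial>haar \<alpha>) = g s * d_const \<alpha>"
      by (simp add: mult.commute)
  qed
  also have "\<dots> = (\<integral>\<^sup>+s. g s \<partial>haar \<alpha>) * d_const \<alpha>"
    by (rule nn_integral_multc) measurable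
  finally show ?thesis
    using d_const_pos[OF \<alpha>] d_const_finite[OF \<alpha>]
    by (auto simp: mult.commute[of _ "d_const \<alpha>"] ennreal_mult_cancel_left)
qed

section \<open>Independent random elements\<close>

text \<open>
  For fixed \<open>B\<close>, independence says that the law of \<open>X\<close> restricted to the event \<open>Y \<in> B\<close> is a multiple
  of the law of \<open>X\<close>; integrating \<open>f\<close> against both measures gives the product formula.
\<close>

lemma nn_integral_independent_elements:
  assumes P: "prob_space P" and ind: "independent_elements P N X N' Y"
    and f: "f \<in> borel_measurable N" and B: "B \<in> sets N'"
  shows "(\<integral>\<^sup>+\<omega>. f (X \<omega>) * indicator B (Y \<omega>) \<partial>P) = (\<integral>\<^sup>+\<omega>. f (X \<omega>) \<partial>P) * emeasure (distr P N' Y) B"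
proof -
  interpret prob_space P by (rule P)
  have X [measurable]: "X \<in> P \<rightarrow>\<^sub>M N" and Y [measurable]: "Y \<in> P \<rightarrow>\<^sub>M N'"
    using ind by (simp_all add: independent_elements_def)
  have [measurable]: "B \<in> sets N'" by (rule B)
  let ?Q = "distr (density P (\<lambda>\<omega>. indicator B (Y \<omega>))) N X"
  have "?Q = scale_measure (emeasure (distr P N' Y) B) (distr P N X)"
  proof (rule measure_eqI)
    fix A assume "A \<in> sets ?Q"
    then have A [measurable]: "A \<in> sets N" by simp
    have "emeasure ?Q A = emeasure P ((X -` A \<inter> space P) \<inter> (Y -` B \<inter> space P))"
    proof -
      have "emeasure ?Q A = emeasure (density P (\<lambda>\<omega>. indicator B (Y \<omega>))) (X -` A \<inter> space P)"
        by (subst emeasure_distr) simp_all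
      also have "\<dots> = (\<integral>\<^sup>+\<omega>. indicator B (Y \<omega>) * indicator (X -` A \<inter> space P) \<omega> \<partial>P)"
        by (rule emeasure_density) measurable
      also have "\<dots> = (\<integral>\<^sup>+\<omega>. indicator ((X -` A \<inter> space P) \<inter> (Y -` B \<inter> space P)) \<omega> \<partial>P)"
        by (rule nn_integral_cong) (auto simp: indicator_def)
      finally show ?thesis by simp
    qed
    also have "\<dots> = emeasure P (X -` A \<inter> space P) * emeasure P (Y -` B \<inter> space P)"
    proof -
      have "prob ((X -` A \<inter> space P) \<inter> (Y -` B \<inter> space P)) = prob (X -` A \<inter> space P) * prob (Y -` B \<inter> space P)"
        using ind A B by (intro indep_setD) (auto simp: independent_elements_def)
      then show ?thesis
        by (simp add: emeasure_eq_measure ennreal_mult)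
    qed
    finally show "emeasure ?Q A = emeasure (scale_measure (emeasure (distr P N' Y) B) (distr P N X)) A"
      by (simp add: emeasure_distr mult.commute)
  qed simp
  then have "(\<integral>\<^sup>+x. f x \<partial>?Q) = emeasure (distr P N' Y) B * (\<integral>\<^sup>+x. f x \<partial>distr P N X)"
    using f by (simp add: nn_integral_scale_measure)
  then show ?thesis
    using f by (simp add: nn_integral_distr nn_integral_density mult.commute)
qed

lemma (in prob_space) independent_elements_const:
  assumes X: "X \<in> M \<rightarrow>\<^sub>M N" and Y: "Y \<in> M \<rightarrow>\<^sub>M N'" and const: "\<And>\<omega>. \<omega> \<in> space M \<Longrightarrow> X \<omega> = c"
  shows "independent_elements M N X N' Y"
proof -
  have triv: "X -` A \<inter> space M = {} \<or> X -` A \<inter> space M = space M" for A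
    using const by auto
  have "indep_set {X -` A \<inter> space M |A. A \<in> sets N} {Y -` B \<inter> space M |B. B \<in> sets N'}"
    unfolding indep_sets2_eq
  proof (intro conjI ballI)
    fix a b assume "a \<in> {X -` A \<inter> space M |A. A \<in> sets N}" "b \<in> {Y -` B \<inter> space M |B. B \<in> sets N'}"
    then have a: "a = {} \<or> a = space M" and b: "b \<subseteq> space M"
      using triv by auto
    from b have "space M \<inter> b = b" by auto
    then show "prob (a \<inter> b) = prob a * prob b"
      using a by (auto simp: prob_space)
  qed (use X Y in \<open>auto intro: measurable_sets\<close>)
  with X Y show ?thesis by (simp add: independent_elements_def)
qed

section \<open>Orbit measures and measures on the section\<close>

text \<open>
  The part of the setting that does not involve the homogeneous measure.
\<close>

locale gauged_action =
  fixes M :: "'e measure"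
    and S :: "real ^ 'q \<Rightarrow> 'e \<Rightarrow> 'e"
    and \<alpha> :: "real ^ 'q"
    and \<tau> :: "'e \<Rightarrow> real ^ 'q"
    and w :: 'e
  assumes \<alpha>: "\<alpha> \<in> pos_orthant"
    and action: "measurable_action M S"
    and gauge: "product_gauge M S \<tau>"
    and base_point: "w \<in> gauge_section M \<tau>"
begin

abbreviation "E\<^sub>\<tau> \<equiv> gauge_dom M \<tau>"
abbreviation "\<Sigma>\<^sub>\<tau> \<equiv> section_space M \<tau>"
abbreviation "\<Pi>\<^sub>\<tau> \<equiv> section_proj M S \<tau> w"

text \<open>
  The law of the section point, weighted by the character of the radius. \<open>P\<close> is an arbitrary measure,
  because the definition is also applied to the possibly infinite measure \<open>h \<nu>\<close>.
\<close>

definition section_measure :: "'w measure \<Rightarrow> ('w \<Rightarrow> 'e) \<Rightarrow> 'e measure" where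
  "section_measure P Z =
     distr (density P (\<lambda>\<omega>. ennreal (chi \<alpha> (\<tau> (Z \<omega>))))) \<Sigma>\<^sub>\<tau> (\<lambda>\<omega>. \<Pi>\<^sub>\<tau> (Z \<omega>))"

lemma measurable_gauge [measurable]: "\<tau> \<in> M \<rightarrow>\<^sub>M borel"
  using gauge by (simp add: product_gauge_def)

lemma dom_sets [measurable]: "E\<^sub>\<tau> \<in> sets M"
  by (rule gauge_dom_sets[OF gauge])

lemma measurable_proj [measurable]: "\<Pi>\<^sub>\<tau> \<in> M \<rightarrow>\<^sub>M \<Sigma>\<^sub>\<tau>"
  by (rule measurable_section_proj[OF action gauge base_point])

lemma measurable_joint_action [measurable]: "(\<lambda>(r, x). S r x) \<in> theta \<alpha> \<Otimes>\<^sub>M M \<rightarrow>\<^sub>M M"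
  using action unfolding measurable_action_def
  by (simp add: sets_theta cong: measurable_cong_sets sets_pair_measure_cong)

lemma measurable_theta_borel: "(\<lambda>r. r) \<in> theta \<alpha> \<rightarrow>\<^sub>M borel"
  unfolding measurable_cong_sets[OF sets_theta refl] by (rule measurable_restrict_space1) simp

lemma C_star_sets_theta [measurable]: "C_star \<in> sets (theta \<alpha>)"
  using C_star_subset_pos_orthant by (simp add: sets_theta sets_restrict_space_iff)

lemma measurable_action_at: "r \<in> pos_orthant \<Longrightarrow> S r \<in> M \<rightarrow>\<^sub>M M"
  using measurable_Pair2[OF measurable_joint_action, of r] by simp

lemma measurable_orbit_map: "x \<in> space M \<Longrightarrow> (\<lambda>r. S r x) \<in> theta \<alpha> \<rightarrow>\<^sub>M M"
  using measurable_Pair1[OF measurable_joint_action, of x] by simp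

lemma action_space: "r \<in> pos_orthant \<Longrightarrow> x \<in> space M \<Longrightarrow> S r x \<in> space M"
  by (rule measurable_space[OF measurable_action_at])

lemma action_one: "x \<in> space M \<Longrightarrow> S 1 x = x"
  using action by (simp add: measurable_action_def)

lemma action_mult:
  "r \<in> pos_orthant \<Longrightarrow> s \<in> pos_orthant \<Longrightarrow> x \<in> space M \<Longrightarrow> S r (S s x) = S (r * s) x"
  using action by (simp add: measurable_action_def)

lemma gauge_action: "r \<in> pos_orthant \<Longrightarrow> x \<in> space M \<Longrightarrow> \<tau> (S r x) = r * \<tau> x"
  using gauge by (simp add: product_gauge_def)

lemma dom_iff: "x \<in> E\<^sub>\<tau> \<longleftrightarrow> x \<in> space M \<and> \<tau> x \<in> pos_orthant"
  by (simp add: gauge_dom_def pos_orthant_def)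

lemma action_dom_iff:
  "r \<in> pos_orthant \<Longrightarrow> x \<in> space M \<Longrightarrow> S r x \<in> E\<^sub>\<tau> \<longleftrightarrow> x \<in> E\<^sub>\<tau>"
  by (simp add: dom_iff action_space gauge_action mult_in_pos_orthant_iff)

lemma space_section: "space \<Sigma>\<^sub>\<tau> = gauge_section M \<tau>"
  by (auto simp: section_space_def space_restrict_space gauge_section_def gauge_dom_def)

lemma sectionD:
  assumes "y \<in> space \<Sigma>\<^sub>\<tau>"
  shows "y \<in> space M" "y \<in> E\<^sub>\<tau>" "\<tau> y = 1"
  using assms by (auto simp: space_section gauge_section_def gauge_dom_def)

lemma measurable_section_inclusion: "(\<lambda>y. y) \<in> \<Sigma>\<^sub>\<tau> \<rightarrow>\<^sub>M M"
  unfolding section_space_def by (rule measurable_restrict_space1) simp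

lemma proj_section: "x \<in> space M \<Longrightarrow> \<Pi>\<^sub>\<tau> x \<in> space \<Sigma>\<^sub>\<tau>"
  by (rule measurable_space[OF measurable_proj])

lemma proj_action:
  assumes r: "r \<in> pos_orthant" and x: "x \<in> E\<^sub>\<tau>"
  shows "\<Pi>\<^sub>\<tau> (S r x) = \<Pi>\<^sub>\<tau> x"
proof -
  have x': "x \<in> space M" "\<tau> x \<in> pos_orthant" using x by (simp_all add: dom_iff)
  have "vec_inv (r * \<tau> x) * r = (r * vec_inv r) * vec_inv (\<tau> x)"
    by (simp add: vec_inv_mult_distrib ac_simps)
  then have "vec_inv (r * \<tau> x) * r = vec_inv (\<tau> x)"
    by (simp add: mult_vec_inv[OF r])
  then show ?thesis
    using r x x' by (simp add: section_proj_def action_dom_iff gauge_action action_mult)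
qed

lemma proj_on_section: "y \<in> space \<Sigma>\<^sub>\<tau> \<Longrightarrow> \<Pi>\<^sub>\<tau> y = y"
  using sectionD[of y] by (simp add: section_proj_def action_one)

lemma action_gauge_proj:
  assumes x: "x \<in> E\<^sub>\<tau>"
  shows "S (\<tau> x) (\<Pi>\<^sub>\<tau> x) = x"
proof -
  have "x \<in> space M" "\<tau> x \<in> pos_orthant" using x by (simp_all add: dom_iff)
  then show ?thesis
    using x by (simp add: section_proj_def action_mult mult_vec_inv action_one)
qed

lemma borel_measurable_orbit_integral:
  assumes [measurable]: "f \<in> borel_measurable M"
  shows "(\<lambda>x. \<integral>\<^sup>+r. f (S r x) \<partial>theta \<alpha>) \<in> borel_measurable M"
proof -
  interpret T: sigma_finite_measure "theta \<alpha>" by (rule sigma_finite_theta)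
  have "(\<lambda>(x, r). f (S r x)) \<in> borel_measurable (M \<Otimes>\<^sub>M theta \<alpha>)"
    by measurable
  from T.borel_measurable_nn_integral[OF this] show ?thesis by simp
qed

lemma sets_orbit_measure [simp]: "sets (orbit_measure M S \<alpha> P Z) = sets M"
  by (simp add: orbit_measure_def)

text \<open>
  The orbit measure is the image of \<open>P \<otimes> \<theta>\<close> under \<open>(\<omega>, r) \<mapsto> S r (Z \<omega>)\<close>.
\<close>

lemma nn_integral_orbit_measure:
  assumes Z [measurable]: "Z \<in> P \<rightarrow>\<^sub>M M" and f [measurable]: "f \<in> borel_measurable M"
  shows "(\<integral>\<^sup>+x. f x \<partial>orbit_measure M S \<alpha> P Z) = (\<integral>\<^sup>+\<omega>. (\<integral>\<^sup>+r. f (S r (Z \<omega>)) \<partial>theta \<alpha>) \<partial>P)"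
proof -
  interpret T: sigma_finite_measure "theta \<alpha>" by (rule sigma_finite_theta)
  let ?\<Phi> = "\<lambda>(\<omega>, r). S r (Z \<omega>)"
  have \<Phi> [measurable]: "?\<Phi> \<in> P \<Otimes>\<^sub>M theta \<alpha> \<rightarrow>\<^sub>M M" by measurable
  have iter: "(\<integral>\<^sup>+z. g z \<partial>distr (P \<Otimes>\<^sub>M theta \<alpha>) M ?\<Phi>) = (\<integral>\<^sup>+\<omega>. (\<integral>\<^sup>+r. g (S r (Z \<omega>)) \<partial>theta \<alpha>) \<partial>P)"
    if g [measurable]: "g \<in> borel_measurable M" for g :: "'e \<Rightarrow> ennreal"
    by (simp add: nn_integral_distr T.nn_integral_fst[symmetric])
  have "orbit_measure M S \<alpha> P Z = distr (P \<Otimes>\<^sub>M theta \<alpha>) M ?\<Phi>"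
  proof (rule measure_eqI)
    fix A assume "A \<in> sets (orbit_measure M S \<alpha> P Z)"
    then have A: "A \<in> sets M" by simp
    have "emeasure (distr (P \<Otimes>\<^sub>M theta \<alpha>) M ?\<Phi>) A = (\<integral>\<^sup>+z. indicator A z \<partial>distr (P \<Otimes>\<^sub>M theta \<alpha>) M ?\<Phi>)"
      using A by simp
    then show "emeasure (orbit_measure M S \<alpha> P Z) A = emeasure (distr (P \<Otimes>\<^sub>M theta \<alpha>) M ?\<Phi>) A"
      using A by (simp only: iter borel_measurable_indicator emeasure_orbit_measure[OF action Z])
  qed simp
  then show ?thesis by (simp only: iter f)
qed

lemma sets_section_measure [simp, measurable_cong]: "sets (section_measure P Z) = sets \<Sigma>\<^sub>\<tau>"
  by (simp add: section_measure_def)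

lemma nn_integral_section_measure:
  assumes [measurable]: "Z \<in> P \<rightarrow>\<^sub>M M" "g \<in> borel_measurable \<Sigma>\<^sub>\<tau>"
  shows "(\<integral>\<^sup>+y. g y \<partial>section_measure P Z) = (\<integral>\<^sup>+\<omega>. ennreal (chi \<alpha> (\<tau> (Z \<omega>))) * g (\<Pi>\<^sub>\<tau> (Z \<omega>)) \<partial>P)"
  unfolding section_measure_def by (simp add: nn_integral_distr nn_integral_density)

lemma emeasure_section_measure:
  assumes "Z \<in> P \<rightarrow>\<^sub>M M" "D \<in> sets \<Sigma>\<^sub>\<tau>"
  shows "emeasure (section_measure P Z) D =
    (\<integral>\<^sup>+\<omega>. ennreal (chi \<alpha> (\<tau> (Z \<omega>))) * indicator D (\<Pi>\<^sub>\<tau> (Z \<omega>)) \<partial>P)"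
  using nn_integral_section_measure[OF assms(1), of "indicator D"] assms(2) by simp

text \<open>
  Since \<open>Z = S (\<tau> Z) (\<Pi> Z)\<close>, passing from \<open>Z\<close> to \<open>\<Pi> Z\<close> translates the integration variable of
  \<^term>\<open>theta \<alpha>\<close> by \<open>\<tau> Z\<close>, and the resulting factor \<open>\<chi>(\<tau> Z)\<close> is the weight in
  \<^const>\<open>section_measure\<close>.
\<close>

lemma orbit_measure_section_measure:
  assumes Z [measurable]: "Z \<in> P \<rightarrow>\<^sub>M M" and conc: "AE \<omega> in P. Z \<omega> \<in> E\<^sub>\<tau>"
  shows "orbit_measure M S \<alpha> (section_measure P Z) (\<lambda>y. y) = orbit_measure M S \<alpha> P Z"
proof (rule measure_eqI)
  fix A assume "A \<in> sets (orbit_measure M S \<alpha> (section_measure P Z) (\<lambda>y. y))"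
  then have A [measurable]: "A \<in> sets M" by simp
  have id: "(\<lambda>y. y) \<in> section_measure P Z \<rightarrow>\<^sub>M M"
    using measurable_section_inclusion by (simp cong: measurable_cong_sets)
  have [measurable]: "(\<lambda>x. \<integral>\<^sup>+r. indicator A (S r x) \<partial>theta \<alpha>) \<in> borel_measurable M"
    by (rule borel_measurable_orbit_integral) simp
  have "emeasure (orbit_measure M S \<alpha> (section_measure P Z) (\<lambda>y. y)) A =
      (\<integral>\<^sup>+\<omega>. ennreal (chi \<alpha> (\<tau> (Z \<omega>))) * (\<integral>\<^sup>+r. indicator A (S r (\<Pi>\<^sub>\<tau> (Z \<omega>))) \<partial>theta \<alpha>) \<partial>P)"
    unfolding emeasure_orbit_measure[OF action id A]
    by (intro nn_integral_section_measure measurable_compose[OF measurable_section_inclusion]) measurable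
  also have "\<dots> = (\<integral>\<^sup>+\<omega>. (\<integral>\<^sup>+r. indicator A (S r (Z \<omega>)) \<partial>theta \<alpha>) \<partial>P)"
  proof (rule nn_integral_cong_AE, rule AE_mp[OF conc], intro AE_I2 impI)
    fix \<omega> assume z: "Z \<omega> \<in> E\<^sub>\<tau>"
    then have t: "\<tau> (Z \<omega>) \<in> pos_orthant" and z': "Z \<omega> \<in> space M" by (simp_all add: dom_iff)
    have pz: "\<Pi>\<^sub>\<tau> (Z \<omega>) \<in> space M" using sectionD(1)[OF proj_section[OF z']] .
    note measurable_orbit_map[OF pz, measurable]
    have g: "(\<lambda>r. indicator A (S r (\<Pi>\<^sub>\<tau> (Z \<omega>))) :: ennreal) \<in> borel_measurable (theta \<alpha>)"
      by measurable
    have "(\<integral>\<^sup>+r. indicator A (S r (Z \<omega>)) \<partial>theta \<alpha>) =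
        (\<integral>\<^sup>+r. indicator A (S (r * \<tau> (Z \<omega>)) (\<Pi>\<^sub>\<tau> (Z \<omega>))) \<partial>theta \<alpha>)"
      using action_mult[OF _ t pz] action_gauge_proj[OF z]
      by (intro nn_integral_cong) (simp flip: action_mult)
    then show "ennreal (chi \<alpha> (\<tau> (Z \<omega>))) * (\<integral>\<^sup>+r. indicator A (S r (\<Pi>\<^sub>\<tau> (Z \<omega>))) \<partial>theta \<alpha>) =
        (\<integral>\<^sup>+r. indicator A (S r (Z \<omega>)) \<partial>theta \<alpha>)"
      using nn_integral_theta_scale[OF t g] by simp
  qed
  also have "\<dots> = emeasure (orbit_measure M S \<alpha> P Z) A"
    by (rule emeasure_orbit_measure[OF action Z A, symmetric])
  finally show "emeasure (orbit_measure M S \<alpha> (section_measure P Z) (\<lambda>y. y)) A =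
      emeasure (orbit_measure M S \<alpha> P Z) A" .
qed simp

text \<open>
  Starting from a point \<open>y\<close> of the section, the gauge at \<open>S r y\<close> is \<open>r\<close> and the section point is
  \<open>y\<close>, so the orbit integral splits into a product.
\<close>

lemma nn_integral_orbit_measure_slice:
  assumes \<rho> [measurable_cong]: "sets \<rho> = sets \<Sigma>\<^sub>\<tau>" and D [measurable]: "D \<in> sets \<Sigma>\<^sub>\<tau>"
  shows "(\<integral>\<^sup>+x. indicator C_star (\<tau> x) * indicator D (\<Pi>\<^sub>\<tau> x) \<partial>orbit_measure M S \<alpha> \<rho> (\<lambda>y. y)) =
    emeasure (theta \<alpha>) C_star * emeasure \<rho> D"
proof -
  have sp: "space \<rho> = space \<Sigma>\<^sub>\<tau>" by (rule sets_eq_imp_space_eq[OF \<rho>])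
  have "(\<integral>\<^sup>+x. indicator C_star (\<tau> x) * indicator D (\<Pi>\<^sub>\<tau> x) \<partial>orbit_measure M S \<alpha> \<rho> (\<lambda>y. y)) =
      (\<integral>\<^sup>+y. (\<integral>\<^sup>+r. indicator C_star (\<tau> (S r y)) * indicator D (\<Pi>\<^sub>\<tau> (S r y)) \<partial>theta \<alpha>) \<partial>\<rho>)"
    using measurable_section_inclusion
    by (intro nn_integral_orbit_measure) (simp cong: measurable_cong_sets[OF \<rho> refl], measurable)
  also have "\<dots> = (\<integral>\<^sup>+y. emeasure (theta \<alpha>) C_star * indicator D y \<partial>\<rho>)"
  proof (rule nn_integral_cong)
    fix y assume "y \<in> space \<rho>"
    then have y: "y \<in> space \<Sigma>\<^sub>\<tau>" by (simp add: sp)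
    have "(\<integral>\<^sup>+r. indicator C_star (\<tau> (S r y)) * indicator D (\<Pi>\<^sub>\<tau> (S r y)) \<partial>theta \<alpha>) =
        (\<integral>\<^sup>+r. indicator C_star r * indicator D y \<partial>theta \<alpha>)"
      by (intro nn_integral_cong)
        (simp add: gauge_action sectionD[OF y] proj_action proj_on_section[OF y])
    also have "\<dots> = emeasure (theta \<alpha>) C_star * indicator D y"
      by (simp add: nn_integral_multc)
    finally show "(\<integral>\<^sup>+r. indicator C_star (\<tau> (S r y)) * indicator D (\<Pi>\<^sub>\<tau> (S r y)) \<partial>theta \<alpha>) =
        emeasure (theta \<alpha>) C_star * indicator D y" .
  qed
  also have "\<dots> = emeasure (theta \<alpha>) C_star * emeasure \<rho> D"
    by (rule nn_integral_cmult_indicator) (simp add: \<rho>)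
  finally show ?thesis .
qed

text \<open>
  The slice \<open>{\<tau> \<in> C_star}\<close> has positive finite mass along every orbit, and therefore determines the
  measure on the section.
\<close>

lemma orbit_measure_section_inject:
  assumes \<rho>: "sets \<rho> = sets \<Sigma>\<^sub>\<tau>" and \<rho>': "sets \<rho>' = sets \<Sigma>\<^sub>\<tau>"
    and eq: "orbit_measure M S \<alpha> \<rho> (\<lambda>y. y) = orbit_measure M S \<alpha> \<rho>' (\<lambda>y. y)"
  shows "\<rho> = \<rho>'"
proof (rule measure_eqI)
  fix D assume "D \<in> sets \<rho>"
  then have D: "D \<in> sets \<Sigma>\<^sub>\<tau>" by (simp add: \<rho>)
  have "emeasure (theta \<alpha>) C_star * emeasure \<rho> D = emeasure (theta \<alpha>) C_star * emeasure \<rho>' D"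
    using nn_integral_orbit_measure_slice[OF \<rho> D] nn_integral_orbit_measure_slice[OF \<rho>' D]
    by (simp add: eq)
  then show "emeasure \<rho> D = emeasure \<rho>' D"
    using emeasure_theta_C_star_pos[OF \<alpha>] emeasure_theta_C_star_finite[OF \<alpha>]
    by (auto simp: ennreal_mult_cancel_left)
qed (simp add: \<rho> \<rho>')

lemma section_measure_constant_gauge:
  assumes Z [measurable]: "Z \<in> P \<rightarrow>\<^sub>M M" and const: "AE \<omega> in P. \<tau> (Z \<omega>) = a"
  shows "section_measure P Z = scale_measure (ennreal (chi \<alpha> a)) (distr P \<Sigma>\<^sub>\<tau> (\<lambda>\<omega>. \<Pi>\<^sub>\<tau> (Z \<omega>)))"
proof (rule measure_eqI)
  fix D assume "D \<in> sets (section_measure P Z)"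
  then have D [measurable]: "D \<in> sets \<Sigma>\<^sub>\<tau>" by simp
  have "emeasure (section_measure P Z) D = (\<integral>\<^sup>+\<omega>. ennreal (chi \<alpha> a) * indicator D (\<Pi>\<^sub>\<tau> (Z \<omega>)) \<partial>P)"
    unfolding emeasure_section_measure[OF Z D]
    by (rule nn_integral_cong_AE) (use const in auto)
  also have "\<dots> = ennreal (chi \<alpha> a) * (\<integral>\<^sup>+y. indicator D y \<partial>distr P \<Sigma>\<^sub>\<tau> (\<lambda>\<omega>. \<Pi>\<^sub>\<tau> (Z \<omega>)))"
    by (subst nn_integral_distr) (simp_all add: nn_integral_cmult)
  finally show "emeasure (section_measure P Z) D =
      emeasure (scale_measure (ennreal (chi \<alpha> a)) (distr P \<Sigma>\<^sub>\<tau> (\<lambda>\<omega>. \<Pi>\<^sub>\<tau> (Z \<omega>)))) D"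
    by simp
qed simp

lemma section_measure_independent:
  assumes P: "prob_space P" and Z [measurable]: "Z \<in> P \<rightarrow>\<^sub>M M"
    and ind: "independent_elements P borel (\<lambda>\<omega>. \<tau> (Z \<omega>)) \<Sigma>\<^sub>\<tau> (\<lambda>\<omega>. \<Pi>\<^sub>\<tau> (Z \<omega>))"
  shows "section_measure P Z =
    scale_measure (\<integral>\<^sup>+\<omega>. ennreal (chi \<alpha> (\<tau> (Z \<omega>))) \<partial>P) (distr P \<Sigma>\<^sub>\<tau> (\<lambda>\<omega>. \<Pi>\<^sub>\<tau> (Z \<omega>)))"
proof (rule measure_eqI)
  fix D assume "D \<in> sets (section_measure P Z)"
  then have D: "D \<in> sets \<Sigma>\<^sub>\<tau>" by simp
  show "emeasure (section_measure P Z) D =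
      emeasure (scale_measure (\<integral>\<^sup>+\<omega>. ennreal (chi \<alpha> (\<tau> (Z \<omega>))) \<partial>P) (distr P \<Sigma>\<^sub>\<tau> (\<lambda>\<omega>. \<Pi>\<^sub>\<tau> (Z \<omega>)))) D"
    using nn_integral_independent_elements[OF P ind, of "\<lambda>r. ennreal (chi \<alpha> r)" D] D
    by (simp add: emeasure_section_measure)
qed simp

end

section \<open>Disintegration of a homogeneous measure\<close>

locale homogeneous_gauged_action = gauged_action M S \<alpha> \<tau> w
  for M :: "'e measure" and S :: "real ^ 'q \<Rightarrow> 'e \<Rightarrow> 'e" and \<alpha> \<tau> w +
  fixes \<nu> :: "'e measure"
  assumes homogeneous: "\<nu> \<in> homogeneous_measures M S \<alpha>"
    and admissible: "admissible_gauge M S \<nu> \<tau>"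
begin

abbreviation "\<sigma>\<^sub>\<tau> \<equiv> varsigma M S \<alpha> \<nu> \<tau> w"
abbreviation "s\<^sub>\<tau> \<equiv> s_const M S \<alpha> \<nu> \<tau> w"
abbreviation "a\<^sub>\<tau> \<equiv> a_vec M S \<alpha> \<nu> \<tau> w"
abbreviation "Q\<^sub>\<tau> \<equiv> varsigma_normalized M S \<alpha> \<nu> \<tau> w"

lemma sets_nu [simp, measurable_cong]: "sets \<nu> = sets M"
  using homogeneous by (simp add: homogeneous_measures_def)

lemma space_nu: "space \<nu> = space M"
  by (rule sets_eq_imp_space_eq) simp

sublocale nu: sigma_finite_measure \<nu>
  using homogeneous by (simp add: homogeneous_measures_def)

lemma AE_nu_dom: "AE x in \<nu>. x \<in> E\<^sub>\<tau>"
  by (rule AE_I[of _ _ "space M - E\<^sub>\<tau>"])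
    (use admissible in \<open>auto simp: admissible_gauge_def space_nu\<close>)

text \<open>
  Homogeneity is stated for direct images of sets. The preimage of \<open>A\<close> under \<open>S r\<close> is the direct image
  under the inverse group element, which turns \<open>\<chi>\<close> into its reciprocal.
\<close>

lemma nn_integral_nu_action:
  assumes r: "r \<in> pos_orthant" and f: "f \<in> borel_measurable M"
  shows "(\<integral>\<^sup>+x. f (S r x) \<partial>\<nu>) = ennreal (chi \<alpha> r) * (\<integral>\<^sup>+x. f x \<partial>\<nu>)"
proof -
  have Sr: "S r \<in> \<nu> \<rightarrow>\<^sub>M M"
    using measurable_action_at[OF r] by (simp cong: measurable_cong_sets)
  have "distr \<nu> M (S r) = scale_measure (ennreal (chi \<alpha> r)) \<nu>"
  proof (rule measure_eqI)
    fix A assume "A \<in> sets (distr \<nu> M (S r))"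
    then have A: "A \<in> sets M" by simp
    have "S r -` A \<inter> space \<nu> = S (vec_inv r) ` A"
    proof (intro set_eqI iffI)
      fix x assume "x \<in> S r -` A \<inter> space \<nu>"
      then have "S r x \<in> A" "S (vec_inv r) (S r x) = x"
        using r by (simp_all add: space_nu action_mult vec_inv_mult action_one)
      then show "x \<in> S (vec_inv r) ` A" by (metis imageI)
    next
      fix x assume "x \<in> S (vec_inv r) ` A"
      then obtain y where y: "y \<in> A" "x = S (vec_inv r) y" by auto
      then have "y \<in> space M" using A sets.sets_into_space by auto
      then show "x \<in> S r -` A \<inter> space \<nu>"
        using r y by (simp add: space_nu action_mult mult_vec_inv action_one action_space)
    qed
    then have "emeasure (distr \<nu> M (S r)) A = emeasure \<nu> (S (vec_inv r) ` A)"
      by (simp add: emeasure_distr[OF Sr A])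
    also have "\<dots> = ennreal (inverse (chi \<alpha> (vec_inv r))) * emeasure \<nu> A"
      using homogeneous A r by (simp add: homogeneous_measures_def)
    finally show "emeasure (distr \<nu> M (S r)) A = emeasure (scale_measure (ennreal (chi \<alpha> r)) \<nu>) A"
      by (simp add: chi_vec_inv[OF r])
  qed simp
  then have "(\<integral>\<^sup>+x. f x \<partial>distr \<nu> M (S r)) = ennreal (chi \<alpha> r) * (\<integral>\<^sup>+x. f x \<partial>\<nu>)"
    using f by (simp add: nn_integral_scale_measure cong: measurable_cong_sets)
  then show ?thesis
    using f by (simp add: nn_integral_distr[OF Sr])
qed

text \<open>
  The measure \<open>h \<nu>\<close>, with a weight \<open>h\<close> whose Haar integral along each orbit of a point with
  positive gauge is \<open>1\<close>.
\<close>

definition weighted_nu :: "'e measure" where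
  "weighted_nu = density \<nu> (h_weight \<alpha> \<tau>)"

lemma borel_measurable_h_weight [measurable]: "h_weight \<alpha> \<tau> \<in> borel_measurable M"
  unfolding h_weight_def by measurable

lemma sets_weighted_nu [simp, measurable_cong]: "sets weighted_nu = sets M"
  by (simp add: weighted_nu_def)

lemma nn_integral_weighted_nu:
  assumes "f \<in> borel_measurable M"
  shows "(\<integral>\<^sup>+x. f x \<partial>weighted_nu) = (\<integral>\<^sup>+x. h_weight \<alpha> \<tau> x * f x \<partial>\<nu>)"
  unfolding weighted_nu_def
  by (rule nn_integral_density) (use assms in \<open>simp_all cong: measurable_cong_sets\<close>)

text \<open>
  The existence half of the disintegration. Multiplied by \<^term>\<open>d_const \<alpha>\<close>, the mass
  \<open>\<nu> A\<close> becomes a double integral of \<open>1\<^sub>A(x) 1{\<tau>(S r x) \<in> C_star}\<close> over \<open>x\<close> and \<open>r\<close>. Homogeneity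
  replaces \<open>x\<close> by \<open>S (vec_inv r) x\<close> at the price of \<open>\<chi> r\<close>, and inverting \<open>r\<close> gives the density
  \<open>1 / \<chi>\<close> that takes Haar measure back to \<^term>\<open>theta \<alpha>\<close>.
\<close>

lemma orbit_measure_weighted_nu: "orbit_measure M S \<alpha> weighted_nu (\<lambda>x. x) = \<nu>"
proof (rule measure_eqI)
  fix A assume "A \<in> sets (orbit_measure M S \<alpha> weighted_nu (\<lambda>x. x))"
  then have A [measurable]: "A \<in> sets M" by simp
  interpret m: sigma_finite_measure "haar \<alpha>" by (rule sigma_finite_haar[OF \<alpha>])
  interpret nm: pair_sigma_finite \<nu> "haar \<alpha>" ..
  have sets: "sets (haar \<alpha>) = sets (restrict_space borel pos_orthant)"
    by (simp add: sets_haar sets_theta)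
  have sp: "space (haar \<alpha>) = pos_orthant"
    using sets_eq_imp_space_eq[OF sets_haar] by simp
  note sets_haar [measurable_cong]
  have hb [measurable]: "(\<lambda>r. r) \<in> haar \<alpha> \<rightarrow>\<^sub>M borel"
    using measurable_theta_borel by (simp add: sets_haar cong: measurable_cong_sets)
  have hinv [measurable]: "vec_inv \<in> theta \<alpha> \<rightarrow>\<^sub>M theta \<alpha>"
    unfolding measurable_cong_sets[OF sets_theta sets_theta]
    by (rule measurable_restrict_space3) simp_all
  have tb [measurable]: "(\<lambda>r. r) \<in> theta \<alpha> \<rightarrow>\<^sub>M borel" by (rule measurable_theta_borel)
  let ?C = "indicator C_star :: real ^ 'q \<Rightarrow> ennreal"
  let ?A = "indicator A :: 'e \<Rightarrow> ennreal"
  have At: "(\<lambda>r. ?A (S r x)) \<in> borel_measurable (theta \<alpha>)" if "x \<in> space M" for x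
    by (rule measurable_compose[OF measurable_orbit_map[OF that]]) simp
  \<comment> \<open>By translation invariance, \<open>d_const \<alpha>\<close> is the Haar mass of the group elements that move \<open>x\<close> into the slice.\<close>
  have "d_const \<alpha> * emeasure \<nu> A = (\<integral>\<^sup>+x. ?A x * d_const \<alpha> \<partial>\<nu>)"
    by (subst nn_integral_multc, measurable) (simp add: mult.commute)
  also have "\<dots> = (\<integral>\<^sup>+x. (\<integral>\<^sup>+r. ?A x * ?C (\<tau> (S r x)) \<partial>haar \<alpha>) \<partial>\<nu>)"
  proof (rule nn_integral_cong_AE, rule AE_mp[OF AE_nu_dom], intro AE_I2 impI)
    fix x assume "x \<in> E\<^sub>\<tau>"
    then have x: "x \<in> space M" "\<tau> x \<in> pos_orthant" by (simp_all add: dom_iff)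
    have "(\<integral>\<^sup>+r. ?C (\<tau> (S r x)) \<partial>haar \<alpha>) = (\<integral>\<^sup>+r. ?C (r * \<tau> x) \<partial>haar \<alpha>)"
      by (intro nn_integral_cong) (simp add: sp gauge_action x)
    also have "\<dots> = (\<integral>\<^sup>+r. ?C r \<partial>haar \<alpha>)"
      by (rule nn_integral_haar_scale[OF \<alpha> x(2)]) simp
    also have "\<dots> = d_const \<alpha>"
      using C_star_sets_theta by (simp add: d_const_def sets_haar)
    finally have d: "(\<integral>\<^sup>+r. ?C (\<tau> (S r x)) \<partial>haar \<alpha>) = d_const \<alpha>" .
    note measurable_orbit_map[OF x(1), measurable]
    have "(\<lambda>r. \<tau> (S r x)) \<in> haar \<alpha> \<rightarrow>\<^sub>M borel"
      by measurable
    then show "?A x * d_const \<alpha> = (\<integral>\<^sup>+r. ?A x * ?C (\<tau> (S r x)) \<partial>haar \<alpha>)"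
      by (simp add: nn_integral_cmult d)
  qed
  also have "\<dots> = (\<integral>\<^sup>+r. (\<integral>\<^sup>+x. ?A x * ?C (\<tau> (S r x)) \<partial>\<nu>) \<partial>haar \<alpha>)"
    by (rule nm.Fubini'[symmetric]) measurable
  also have "\<dots> = (\<integral>\<^sup>+r. (\<integral>\<^sup>+x. ?C (\<tau> x) * (ennreal (chi \<alpha> r) * ?A (S (vec_inv r) x)) \<partial>\<nu>) \<partial>haar \<alpha>)"
  proof (rule nn_integral_cong)
    fix r assume "r \<in> space (haar \<alpha>)"
    then have r: "r \<in> pos_orthant" by (simp add: sp)
    note measurable_action_at[OF vec_inv_in_pos_orthant[OF r], measurable]
    have "(\<integral>\<^sup>+x. ?A x * ?C (\<tau> (S r x)) \<partial>\<nu>) = (\<integral>\<^sup>+x. ?A (S (vec_inv r) (S r x)) * ?C (\<tau> (S r x)) \<partial>\<nu>)"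
      using r by (intro nn_integral_cong) (simp add: space_nu action_mult vec_inv_mult action_one)
    also have "\<dots> = ennreal (chi \<alpha> r) * (\<integral>\<^sup>+x. ?A (S (vec_inv r) x) * ?C (\<tau> x) \<partial>\<nu>)"
      by (rule nn_integral_nu_action[OF r]) measurable
    also have "\<dots> = (\<integral>\<^sup>+x. ennreal (chi \<alpha> r) * (?A (S (vec_inv r) x) * ?C (\<tau> x)) \<partial>\<nu>)"
      by (rule nn_integral_cmult[symmetric]) measurable
    finally show "(\<integral>\<^sup>+x. ?A x * ?C (\<tau> (S r x)) \<partial>\<nu>) =
        (\<integral>\<^sup>+x. ?C (\<tau> x) * (ennreal (chi \<alpha> r) * ?A (S (vec_inv r) x)) \<partial>\<nu>)"
      by (simp add: ac_simps)
  qed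
  also have "\<dots> = (\<integral>\<^sup>+x. (\<integral>\<^sup>+r. ?C (\<tau> x) * (ennreal (chi \<alpha> r) * ?A (S (vec_inv r) x)) \<partial>haar \<alpha>) \<partial>\<nu>)"
    by (rule nm.Fubini') measurable
  also have "\<dots> = (\<integral>\<^sup>+x. ?C (\<tau> x) * (\<integral>\<^sup>+r. ?A (S r x) \<partial>theta \<alpha>) \<partial>\<nu>)"
  proof (rule nn_integral_cong)
    fix x assume "x \<in> space \<nu>"
    then have x: "x \<in> space M" by (simp add: space_nu)
    note At[OF x, measurable]
    have [measurable]: "(\<lambda>r. ?A (S (vec_inv r) x)) \<in> borel_measurable (theta \<alpha>)"
      by (rule measurable_compose[OF hinv At[OF x]])
    have "(\<integral>\<^sup>+r. ennreal (chi \<alpha> r) * ?A (S (vec_inv r) x) \<partial>haar \<alpha>) =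
        (\<integral>\<^sup>+r. ennreal (inverse (chi \<alpha> (vec_inv r))) * ?A (S (vec_inv r) x) \<partial>haar \<alpha>)"
      by (intro nn_integral_cong) (simp add: sp chi_vec_inv)
    also have "\<dots> = (\<integral>\<^sup>+r. ennreal (inverse (chi \<alpha> r)) * ?A (S r x) \<partial>haar \<alpha>)"
      by (rule nn_integral_haar_inverse[OF \<alpha>, of "\<lambda>r. ennreal (inverse (chi \<alpha> r)) * ?A (S r x)"]) measurable
    also have "\<dots> = (\<integral>\<^sup>+r. ennreal (chi \<alpha> r) * (ennreal (inverse (chi \<alpha> r)) * ?A (S r x)) \<partial>theta \<alpha>)"
      by (rule nn_integral_haar[OF \<alpha>]) measurable
    also have "\<dots> = (\<integral>\<^sup>+r. ?A (S r x) \<partial>theta \<alpha>)"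
    proof (rule nn_integral_cong)
      fix r assume "r \<in> space (theta \<alpha>)"
      then have "ennreal (chi \<alpha> r) * ennreal (inverse (chi \<alpha> r)) = 1"
        using chi_pos[of r \<alpha>] by (simp flip: ennreal_mult)
      then show "ennreal (chi \<alpha> r) * (ennreal (inverse (chi \<alpha> r)) * ?A (S r x)) = ?A (S r x)"
        by (simp flip: mult.assoc)
    qed
    finally have e: "(\<integral>\<^sup>+r. ennreal (chi \<alpha> r) * ?A (S (vec_inv r) x) \<partial>haar \<alpha>) =
        (\<integral>\<^sup>+r. ?A (S r x) \<partial>theta \<alpha>)" .
    have "(\<integral>\<^sup>+r. ?C (\<tau> x) * (ennreal (chi \<alpha> r) * ?A (S (vec_inv r) x)) \<partial>haar \<alpha>) =
        ?C (\<tau> x) * (\<integral>\<^sup>+r. ennreal (chi \<alpha> r) * ?A (S (vec_inv r) x) \<partial>haar \<alpha>)"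
      by (rule nn_integral_cmult) measurable
    then show "(\<integral>\<^sup>+r. ?C (\<tau> x) * (ennreal (chi \<alpha> r) * ?A (S (vec_inv r) x)) \<partial>haar \<alpha>) =
        ?C (\<tau> x) * (\<integral>\<^sup>+r. ?A (S r x) \<partial>theta \<alpha>)"
      by (simp only: e)
  qed
  also have "\<dots> = d_const \<alpha> * emeasure (orbit_measure M S \<alpha> weighted_nu (\<lambda>x. x)) A"
  proof -
    have [measurable]: "(\<lambda>x. \<integral>\<^sup>+r. ?A (S r x) \<partial>theta \<alpha>) \<in> borel_measurable M"
      by (rule borel_measurable_orbit_integral) simp
    have "d_const \<alpha> * emeasure (orbit_measure M S \<alpha> weighted_nu (\<lambda>x. x)) A =
        d_const \<alpha> * (\<integral>\<^sup>+x. h_weight \<alpha> \<tau> x * (\<integral>\<^sup>+r. ?A (S r x) \<partial>theta \<alpha>) \<partial>\<nu>)"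
      by (subst emeasure_orbit_measure[OF action _ A])
        (simp_all add: nn_integral_weighted_nu)
    also have "\<dots> = (\<integral>\<^sup>+x. d_const \<alpha> * (h_weight \<alpha> \<tau> x * (\<integral>\<^sup>+r. ?A (S r x) \<partial>theta \<alpha>)) \<partial>\<nu>)"
      by (rule nn_integral_cmult[symmetric]) measurable
    also have "\<dots> = (\<integral>\<^sup>+x. ?C (\<tau> x) * (\<integral>\<^sup>+r. ?A (S r x) \<partial>theta \<alpha>) \<partial>\<nu>)"
    proof -
      have "d_const \<alpha> * inverse (d_const \<alpha>) = 1"
        using d_const_pos[OF \<alpha>] d_const_finite[OF \<alpha>] ennreal_divide_self[of "d_const \<alpha>"]
        by (simp add: divide_ennreal_def)
      then show ?thesis
        by (intro nn_integral_cong) (simp add: h_weight_def flip: mult.assoc)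
    qed
    finally show ?thesis by simp
  qed
  finally show "emeasure (orbit_measure M S \<alpha> weighted_nu (\<lambda>x. x)) A = emeasure \<nu> A"
    using d_const_pos[OF \<alpha>] d_const_finite[OF \<alpha>] by (auto simp: ennreal_mult_cancel_left)
qed simp

lemma AE_weighted_nu_dom: "AE x in weighted_nu. x \<in> E\<^sub>\<tau>"
proof -
  have "h_weight \<alpha> \<tau> \<in> borel_measurable \<nu>" by measurable
  then show ?thesis unfolding weighted_nu_def using AE_nu_dom by (subst AE_density) auto
qed

lemma sets_varsigma [simp]: "sets \<sigma>\<^sub>\<tau> = sets \<Sigma>\<^sub>\<tau>"
  by (simp add: varsigma_def)

text \<open>
  The defining integral of \<^const>\<open>varsigma\<close> is that of the section measure of the identity under
  \<open>h \<nu>\<close>, so that the general results on section measures apply to it.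
\<close>

lemma varsigma_eq_section_measure: "\<sigma>\<^sub>\<tau> = section_measure weighted_nu (\<lambda>x. x)"
proof (rule measure_eqI)
  fix D assume "D \<in> sets \<sigma>\<^sub>\<tau>"
  then have D [measurable]: "D \<in> sets \<Sigma>\<^sub>\<tau>" by simp
  have id: "(\<lambda>x. x) \<in> weighted_nu \<rightarrow>\<^sub>M M" by measurable
  have "emeasure \<sigma>\<^sub>\<tau> D = (\<integral>\<^sup>+x. h_weight \<alpha> \<tau> x * (ennreal (chi \<alpha> (\<tau> x)) * indicator D (\<Pi>\<^sub>\<tau> x)) \<partial>\<nu>)"
    unfolding emeasure_varsigma[OF action gauge base_point sets_nu D]
    using AE_nu_dom by (intro nn_integral_cong_AE) (auto simp: ac_simps)
  also have "\<dots> = emeasure (section_measure weighted_nu (\<lambda>x. x)) D"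
    unfolding emeasure_section_measure[OF id D]
    by (rule nn_integral_weighted_nu[symmetric]) measurable
  finally show "emeasure \<sigma>\<^sub>\<tau> D = emeasure (section_measure weighted_nu (\<lambda>x. x)) D" .
qed simp

lemma orbit_measure_varsigma: "orbit_measure M S \<alpha> \<sigma>\<^sub>\<tau> (\<lambda>y. y) = \<nu>"
proof -
  have id: "(\<lambda>x. x) \<in> weighted_nu \<rightarrow>\<^sub>M M" by measurable
  show ?thesis
    unfolding varsigma_eq_section_measure
    using orbit_measure_section_measure[OF id AE_weighted_nu_dom] orbit_measure_weighted_nu by simp
qed

text \<open>
  The set where the gauge vanishes in some coordinate is invariant under the action. Its
  \<open>\<nu>\<close>-mass is thus the probability that \<open>Z\<close> lies in it times the nonzero total mass of
  \<^term>\<open>theta \<alpha>\<close>.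
\<close>

lemma AE_dom_of_orbit_measure:
  assumes Z [measurable]: "Z \<in> P \<rightarrow>\<^sub>M M" and eq: "orbit_measure M S \<alpha> P Z = \<nu>"
  shows "AE \<omega> in P. Z \<omega> \<in> E\<^sub>\<tau>"
proof -
  have N: "space M - E\<^sub>\<tau> \<in> sets M" by measurable
  have "0 = emeasure (orbit_measure M S \<alpha> P Z) (space M - E\<^sub>\<tau>)"
    using admissible eq by (simp add: admissible_gauge_def)
  also have "\<dots> = (\<integral>\<^sup>+\<omega>. (\<integral>\<^sup>+r. indicator (space M - E\<^sub>\<tau>) (S r (Z \<omega>)) \<partial>theta \<alpha>) \<partial>P)"
    by (rule emeasure_orbit_measure[OF action Z N])
  also have "\<dots> = (\<integral>\<^sup>+\<omega>. indicator (space M - E\<^sub>\<tau>) (Z \<omega>) * emeasure (theta \<alpha>) pos_orthant \<partial>P)"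
  proof (rule nn_integral_cong)
    fix \<omega> assume "\<omega> \<in> space P"
    then have z: "Z \<omega> \<in> space M" by (rule measurable_space[OF Z])
    have "(\<integral>\<^sup>+r. indicator (space M - E\<^sub>\<tau>) (S r (Z \<omega>)) \<partial>theta \<alpha>) =
        (\<integral>\<^sup>+r. indicator (space M - E\<^sub>\<tau>) (Z \<omega>) \<partial>theta \<alpha>)"
      by (intro nn_integral_cong) (simp add: indicator_def z action_space action_dom_iff)
    then show "(\<integral>\<^sup>+r. indicator (space M - E\<^sub>\<tau>) (S r (Z \<omega>)) \<partial>theta \<alpha>) =
        indicator (space M - E\<^sub>\<tau>) (Z \<omega>) * emeasure (theta \<alpha>) pos_orthant"
      by simp
  qed
  finally have "(\<integral>\<^sup>+\<omega>. indicator (space M - E\<^sub>\<tau>) (Z \<omega>) * emeasure (theta \<alpha>) pos_orthant \<partial>P) = 0"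
    by (rule sym)
  moreover have "(\<lambda>\<omega>. indicator (space M - E\<^sub>\<tau>) (Z \<omega>) * emeasure (theta \<alpha>) pos_orthant)
      \<in> borel_measurable P"
    by measurable
  ultimately have ae: "AE \<omega> in P. indicator (space M - E\<^sub>\<tau>) (Z \<omega>) * emeasure (theta \<alpha>) pos_orthant = 0"
    by (simp only: nn_integral_0_iff_AE)
  have ne: "emeasure (theta \<alpha>) pos_orthant \<noteq> 0"
  proof -
    have "emeasure (theta \<alpha>) C_star \<le> emeasure (theta \<alpha>) (space (theta \<alpha>))"
      by (rule emeasure_space)
    then show ?thesis using emeasure_theta_C_star_pos[OF \<alpha>] by (auto simp: not_le[symmetric])
  qed
  show ?thesis
  proof (rule AE_mp[OF ae], intro AE_I2 impI)
    fix \<omega>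
    assume "\<omega> \<in> space P"
      and "indicator (space M - E\<^sub>\<tau>) (Z \<omega>) * emeasure (theta \<alpha>) pos_orthant = 0"
    then show "Z \<omega> \<in> E\<^sub>\<tau>"
      using ne measurable_space[OF Z] by (simp add: indicator_def split: if_splits)
  qed
qed

text \<open>
  The orbit measure of \<open>Z\<close> and \<open>\<nu>\<close> are the images of \<open>\<theta> \<otimes> \<rho>\<close> for the two section measures, and
  \<open>\<rho>\<close> is determined by that image. All statements about representers are reduced to this criterion.
\<close>

lemma orbit_measure_eq_iff:
  assumes Z: "Z \<in> P \<rightarrow>\<^sub>M M" and conc: "AE \<omega> in P. Z \<omega> \<in> E\<^sub>\<tau>"
  shows "orbit_measure M S \<alpha> P Z = \<nu> \<longleftrightarrow> section_measure P Z = \<sigma>\<^sub>\<tau>"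
proof
  assume "orbit_measure M S \<alpha> P Z = \<nu>"
  then show "section_measure P Z = \<sigma>\<^sub>\<tau>"
    by - (rule orbit_measure_section_inject,
      simp_all add: orbit_measure_varsigma orbit_measure_section_measure[OF Z conc])
next
  assume "section_measure P Z = \<sigma>\<^sub>\<tau>"
  then show "orbit_measure M S \<alpha> P Z = \<nu>"
    using orbit_measure_section_measure[OF Z conc] orbit_measure_varsigma by simp
qed

lemma section_measure_representer:
  assumes "stochastic_representer M S \<alpha> \<nu> P Z"
  shows "section_measure P Z = \<sigma>\<^sub>\<tau>" "AE \<omega> in P. Z \<omega> \<in> E\<^sub>\<tau>"
proof -
  have Z: "Z \<in> P \<rightarrow>\<^sub>M M" and eq: "orbit_measure M S \<alpha> P Z = \<nu>"
    using assms by (simp_all only: stochastic_representer_def random_element_def)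
  show conc: "AE \<omega> in P. Z \<omega> \<in> E\<^sub>\<tau>" by (rule AE_dom_of_orbit_measure[OF Z eq])
  show "section_measure P Z = \<sigma>\<^sub>\<tau>" using eq by (simp only: orbit_measure_eq_iff[OF Z conc])
qed

section \<open>The total mass of the section measure\<close>

lemma s_const_eq: "s\<^sub>\<tau> = emeasure \<sigma>\<^sub>\<tau> (space \<Sigma>\<^sub>\<tau>)"
  by (simp add: s_const_def space_section)

lemma emeasure_section_measure_space:
  assumes Z: "Z \<in> P \<rightarrow>\<^sub>M M"
  shows "emeasure (section_measure P Z) (space \<Sigma>\<^sub>\<tau>) = (\<integral>\<^sup>+\<omega>. ennreal (chi \<alpha> (\<tau> (Z \<omega>))) \<partial>P)"
  unfolding emeasure_section_measure[OF Z sets.top]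
  by (intro nn_integral_cong) (simp add: proj_section measurable_space[OF Z])

lemma s_const_eq_integral:
  "s\<^sub>\<tau> = inverse (d_const \<alpha>) * (\<integral>\<^sup>+x\<in>{x\<in>space M. \<tau> x \<in> C_star}. ennreal (chi \<alpha> (\<tau> x)) \<partial>\<nu>)"
proof -
  have id: "(\<lambda>x. x) \<in> weighted_nu \<rightarrow>\<^sub>M M" by measurable
  have "s\<^sub>\<tau> = (\<integral>\<^sup>+x. ennreal (chi \<alpha> (\<tau> x)) \<partial>weighted_nu)"
    using emeasure_section_measure_space[OF id] by (simp add: s_const_eq varsigma_eq_section_measure)
  also have "\<dots> = (\<integral>\<^sup>+x. h_weight \<alpha> \<tau> x * ennreal (chi \<alpha> (\<tau> x)) \<partial>\<nu>)"
    by (rule nn_integral_weighted_nu) measurable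
  also have "\<dots> = (\<integral>\<^sup>+x. inverse (d_const \<alpha>) *
      (ennreal (chi \<alpha> (\<tau> x)) * indicator {x\<in>space M. \<tau> x \<in> C_star} x) \<partial>\<nu>)"
    by (intro nn_integral_cong) (auto simp: h_weight_def space_nu indicator_def)
  also have "\<dots> = inverse (d_const \<alpha>) * (\<integral>\<^sup>+x\<in>{x\<in>space M. \<tau> x \<in> C_star}. ennreal (chi \<alpha> (\<tau> x)) \<partial>\<nu>)"
    by (rule nn_integral_cmult) measurable
  finally show ?thesis .
qed

text \<open>
  The slice formula for the whole section.
\<close>

lemma emeasure_nu_C_star:
  "emeasure \<nu> {x\<in>space M. \<tau> x \<in> C_star} = emeasure (theta \<alpha>) C_star * s\<^sub>\<tau>"
proof -
  have "emeasure \<nu> {x\<in>space M. \<tau> x \<in> C_star} = (\<integral>\<^sup>+x. indicator {x\<in>space M. \<tau> x \<in> C_star} x \<partial>\<nu>)"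
    by (rule nn_integral_indicator[symmetric]) measurable
  also have "\<dots> = (\<integral>\<^sup>+x. indicator C_star (\<tau> x) * indicator (space \<Sigma>\<^sub>\<tau>) (\<Pi>\<^sub>\<tau> x) \<partial>\<nu>)"
    by (intro nn_integral_cong) (auto simp: space_nu indicator_def proj_section)
  also have "\<dots> = emeasure (theta \<alpha>) C_star * s\<^sub>\<tau>"
    using nn_integral_orbit_measure_slice[OF sets_varsigma sets.top]
    by (simp add: orbit_measure_varsigma s_const_eq)
  finally show ?thesis .
qed

lemma s_const_eq_quotient:
  "s\<^sub>\<tau> = emeasure \<nu> {x\<in>space M. \<tau> x \<in> C_star} / emeasure (theta \<alpha>) C_star"
  using emeasure_theta_C_star_pos[OF \<alpha>] emeasure_theta_C_star_finite[OF \<alpha>]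
  by (simp add: emeasure_nu_C_star ennreal_times_divide[symmetric] ennreal_mult_divide_eq mult.commute[of _ "s\<^sub>\<tau>"])

lemma s_const_finite_iff:
  "s\<^sub>\<tau> < \<infinity> \<longleftrightarrow> emeasure \<nu> {x\<in>space M. \<tau> x \<in> C_star} < \<infinity>"
  using emeasure_theta_C_star_pos[OF \<alpha>] emeasure_theta_C_star_finite[OF \<alpha>]
  by (auto simp: emeasure_nu_C_star ennreal_mult_less_top)

lemma s_const_pos: "0 < s\<^sub>\<tau>"
proof (rule ccontr)
  assume "\<not> 0 < s\<^sub>\<tau>"
  then have null: "emeasure \<sigma>\<^sub>\<tau> (space \<sigma>\<^sub>\<tau>) = 0"
    by (simp add: s_const_eq sets_eq_imp_space_eq[OF sets_varsigma])
  have id: "(\<lambda>y. y) \<in> \<sigma>\<^sub>\<tau> \<rightarrow>\<^sub>M M"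
    using measurable_section_inclusion by (simp cong: measurable_cong_sets)
  have "AE y in \<sigma>\<^sub>\<tau>. False"
    by (rule AE_I[of _ _ "space \<sigma>\<^sub>\<tau>"]) (use null in \<open>auto simp del: sets_varsigma\<close>)
  then have "emeasure (orbit_measure M S \<alpha> \<sigma>\<^sub>\<tau> (\<lambda>y. y)) (space M) = 0"
    unfolding emeasure_orbit_measure[OF action id sets.top]
    by (subst nn_integral_cong_AE[of _ "\<lambda>_. 0"]) auto
  then show False
    using homogeneous by (simp add: orbit_measure_varsigma homogeneous_measures_def space_nu)
qed

text \<open>
  Let \<open>f > 0\<close> be \<open>\<nu>\<close>-integrable, which exists by \<open>\<sigma>\<close>-finiteness. By disintegration its integral is that
  of the orbit integral \<open>g\<close> of \<open>f\<close> against \<open>\<sigma>\<^sub>\<tau>\<close>. An infinite multiple of \<open>Q\<close> would force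
  \<open>g = 0\<close> almost everywhere with respect to \<open>Q\<close>, although \<open>g > 0\<close> everywhere.
\<close>

lemma varsigma_neq_infinite_multiple:
  assumes Q: "prob_space Q" and sets_Q: "sets Q = sets \<Sigma>\<^sub>\<tau>"
  shows "\<sigma>\<^sub>\<tau> \<noteq> scale_measure \<infinity> Q"
proof
  assume eq: "\<sigma>\<^sub>\<tau> = scale_measure \<infinity> Q"
  interpret Q: prob_space Q by (rule Q)
  have spQ: "space Q = space \<Sigma>\<^sub>\<tau>" by (rule sets_eq_imp_space_eq[OF sets_Q])
  obtain f where f: "f \<in> borel_measurable \<nu>" and fin: "integral\<^sup>N \<nu> f \<noteq> \<infinity>"
    and pos: "\<And>x. x \<in> space \<nu> \<Longrightarrow> 0 < f x"
    using nu.Ex_finite_integrable_function by blast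
  have f' [measurable]: "f \<in> borel_measurable M" using f by (simp cong: measurable_cong_sets)
  have id: "(\<lambda>y. y) \<in> \<sigma>\<^sub>\<tau> \<rightarrow>\<^sub>M M"
    using measurable_section_inclusion by (simp cong: measurable_cong_sets)
  let ?g = "\<lambda>y. \<integral>\<^sup>+r. f (S r y) \<partial>theta \<alpha>"
  have "?g \<in> borel_measurable \<Sigma>\<^sub>\<tau>"
    by (rule measurable_compose[OF measurable_section_inclusion borel_measurable_orbit_integral]) measurable
  then have g: "?g \<in> borel_measurable Q" by (simp add: sets_Q cong: measurable_cong_sets)
  have "integral\<^sup>N \<nu> f = (\<integral>\<^sup>+y. ?g y \<partial>\<sigma>\<^sub>\<tau>)"
    using nn_integral_orbit_measure[OF id f'] by (simp add: orbit_measure_varsigma)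
  also have "\<dots> = \<infinity> * (\<integral>\<^sup>+y. ?g y \<partial>Q)"
    unfolding eq by (rule nn_integral_scale_measure[OF g])
  finally have "(\<integral>\<^sup>+y. ?g y \<partial>Q) = 0"
    using fin by (auto simp: ennreal_top_mult split: if_splits)
  then have ae: "AE y in Q. ?g y = 0"
    by (simp add: nn_integral_0_iff_AE[OF g])
  have ne: "?g y \<noteq> 0" if y: "y \<in> space Q" for y
  proof
    assume z: "?g y = 0"
    have y': "y \<in> space M" using y sectionD(1) by (simp add: spQ)
    note measurable_orbit_map[OF y', measurable]
    have "(\<lambda>r. f (S r y)) \<in> borel_measurable (theta \<alpha>)"
      by measurable
    then have "AE r in theta \<alpha>. f (S r y) = 0"
      using z by (simp add: nn_integral_0_iff_AE)
    then have "AE r in theta \<alpha>. indicator C_star r = (0 :: ennreal)"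
    proof (rule AE_mp, intro AE_I2 impI)
      fix r assume "r \<in> space (theta \<alpha>)" "f (S r y) = 0"
      then show "indicator C_star r = (0 :: ennreal)"
        using pos[of "S r y"] y' by (simp add: space_nu action_space)
    qed
    then have "(\<integral>\<^sup>+r. indicator C_star r \<partial>theta \<alpha>) = 0"
      by (subst nn_integral_0_iff_AE) simp_all
    then show False using emeasure_theta_C_star_pos[OF \<alpha>] by simp
  qed
  have "AE y in Q. False"
    by (rule AE_mp[OF ae], rule AE_I2) (use ne in blast)
  then show False by simp
qed

lemma s_const_finite_of_independent:
  assumes rep: "stochastic_representer M S \<alpha> \<nu> P Z"
    and ind: "independent_elements P borel (\<lambda>\<omega>. \<tau> (Z \<omega>)) \<Sigma>\<^sub>\<tau> (\<lambda>\<omega>. \<Pi>\<^sub>\<tau> (Z \<omega>))"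
  shows "s\<^sub>\<tau> < \<infinity>"
proof (rule ccontr)
  assume "\<not> s\<^sub>\<tau> < \<infinity>"
  then have s: "s\<^sub>\<tau> = \<infinity>" by (simp add: not_less top_unique)
  have P: "prob_space P" and Z [measurable]: "Z \<in> P \<rightarrow>\<^sub>M M"
    using rep by (simp_all add: stochastic_representer_def random_element_def)
  interpret prob_space P by (rule P)
  have "(\<integral>\<^sup>+\<omega>. ennreal (chi \<alpha> (\<tau> (Z \<omega>))) \<partial>P) = \<infinity>"
    using emeasure_section_measure_space[OF Z] section_measure_representer(1)[OF rep] s
    by (simp add: s_const_eq)
  then have "\<sigma>\<^sub>\<tau> = scale_measure \<infinity> (distr P \<Sigma>\<^sub>\<tau> (\<lambda>\<omega>. \<Pi>\<^sub>\<tau> (Z \<omega>)))"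
    using section_measure_independent[OF P Z ind] section_measure_representer(1)[OF rep] by simp
  moreover have "prob_space (distr P \<Sigma>\<^sub>\<tau> (\<lambda>\<omega>. \<Pi>\<^sub>\<tau> (Z \<omega>)))"
    by (rule prob_space_distr) measurable
  ultimately show False
    using varsigma_neq_infinite_multiple[of "distr P \<Sigma>\<^sub>\<tau> (\<lambda>\<omega>. \<Pi>\<^sub>\<tau> (Z \<omega>))"] by simp
qed

section \<open>Finite total mass\<close>

lemma sum_alpha_pos: "0 < (\<Sum>i\<in>UNIV. \<alpha> $ i)"
  using \<alpha> by (intro sum_pos) (simp_all add: pos_orthant_def)

context
  assumes finite: "s\<^sub>\<tau> < \<infinity>"
begin

lemma enn2real_s_pos: "0 < enn2real s\<^sub>\<tau>"
  using s_const_pos finite by (simp add: enn2real_positive_iff)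

lemma a_vec_pos: "a\<^sub>\<tau> \<in> pos_orthant"
  using enn2real_s_pos by (simp add: a_vec_def pos_orthant_def)

text \<open>
  The exponent \<open>1 / \<Sum>j. \<alpha> $ j\<close> in \<^const>\<open>a_vec\<close> is chosen for this identity.
\<close>

lemma chi_a_vec: "ennreal (chi \<alpha> a\<^sub>\<tau>) = s\<^sub>\<tau>"
proof -
  let ?t = "enn2real s\<^sub>\<tau>" and ?b = "\<Sum>i\<in>UNIV. \<alpha> $ i"
  have "chi \<alpha> a\<^sub>\<tau> = (\<Prod>i\<in>UNIV. ?t powr (\<alpha> $ i / ?b))"
    unfolding chi_def a_vec_def by (simp add: powr_powr)
  also have "\<dots> = ?t powr (\<Sum>i\<in>UNIV. \<alpha> $ i / ?b)"
    using enn2real_s_pos by (subst powr_sum) simp_all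
  also have "(\<Sum>i\<in>UNIV. \<alpha> $ i / ?b) = 1"
    using sum_alpha_pos by (simp flip: sum_divide_distrib)
  finally show ?thesis
    using enn2real_s_pos finite by (simp add: ennreal_enn2real)
qed

lemma inverse_s_const: "inverse s\<^sub>\<tau> * s\<^sub>\<tau> = 1" "s\<^sub>\<tau> * inverse s\<^sub>\<tau> = 1"
  using s_const_pos finite ennreal_divide_self[of "s\<^sub>\<tau>"]
  by (simp_all add: divide_ennreal_def mult.commute)

lemma sets_normalized [simp, measurable_cong]: "sets Q\<^sub>\<tau> = sets \<Sigma>\<^sub>\<tau>"
  by (simp add: varsigma_normalized_def)

lemma space_normalized: "space Q\<^sub>\<tau> = space \<Sigma>\<^sub>\<tau>"
  by (rule sets_eq_imp_space_eq) simp

lemma scale_normalized: "scale_measure s\<^sub>\<tau> Q\<^sub>\<tau> = \<sigma>\<^sub>\<tau>"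
  by (simp add: varsigma_normalized_def inverse_s_const)

lemma prob_space_normalized: "prob_space Q\<^sub>\<tau>"
proof (rule prob_spaceI)
  show "emeasure Q\<^sub>\<tau> (space Q\<^sub>\<tau>) = 1"
    unfolding space_normalized
    by (simp add: varsigma_normalized_def s_const_eq[symmetric] inverse_s_const)
qed

lemma eq_normalized_iff: "scale_measure s\<^sub>\<tau> \<mu> = \<sigma>\<^sub>\<tau> \<longleftrightarrow> \<mu> = Q\<^sub>\<tau>"
proof
  assume "scale_measure s\<^sub>\<tau> \<mu> = \<sigma>\<^sub>\<tau>"
  then have "scale_measure (inverse s\<^sub>\<tau>) (scale_measure s\<^sub>\<tau> \<mu>) = Q\<^sub>\<tau>"
    by (simp add: varsigma_normalized_def)
  then show "\<mu> = Q\<^sub>\<tau>" by (simp add: inverse_s_const)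
qed (simp add: scale_normalized)

lemma sets_tilted [simp, measurable_cong]: "sets (tilted_measure M S \<alpha> \<nu> \<tau> w P Z) = sets P"
  by (simp add: tilted_measure_def)

text \<open>
  Tilting by \<open>\<chi>(\<tau> Z) / s\<close> is the same weighting as in \<^const>\<open>section_measure\<close>, divided by the total
  mass.
\<close>

lemma tilted_law:
  assumes Z [measurable]: "Z \<in> P \<rightarrow>\<^sub>M M" and sec: "section_measure P Z = \<sigma>\<^sub>\<tau>"
  shows "distr (tilted_measure M S \<alpha> \<nu> \<tau> w P Z) \<Sigma>\<^sub>\<tau> (\<lambda>\<omega>. \<Pi>\<^sub>\<tau> (Z \<omega>)) = Q\<^sub>\<tau>"
proof (rule measure_eqI)
  let ?T = "tilted_measure M S \<alpha> \<nu> \<tau> w P Z"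
  fix D assume "D \<in> sets (distr ?T \<Sigma>\<^sub>\<tau> (\<lambda>\<omega>. \<Pi>\<^sub>\<tau> (Z \<omega>)))"
  then have D [measurable]: "D \<in> sets \<Sigma>\<^sub>\<tau>" by simp
  have "emeasure (distr ?T \<Sigma>\<^sub>\<tau> (\<lambda>\<omega>. \<Pi>\<^sub>\<tau> (Z \<omega>))) D = (\<integral>\<^sup>+y. indicator D y \<partial>distr ?T \<Sigma>\<^sub>\<tau> (\<lambda>\<omega>. \<Pi>\<^sub>\<tau> (Z \<omega>)))"
    by simp
  also have "\<dots> = (\<integral>\<^sup>+\<omega>. indicator D (\<Pi>\<^sub>\<tau> (Z \<omega>)) \<partial>?T)"
    by (rule nn_integral_distr) measurable
  also have "\<dots> = (\<integral>\<^sup>+\<omega>. ennreal (chi \<alpha> (\<tau> (Z \<omega>))) / s\<^sub>\<tau> * indicator D (\<Pi>\<^sub>\<tau> (Z \<omega>)) \<partial>P)"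
    unfolding tilted_measure_def by (rule nn_integral_density) measurable
  also have "\<dots> = (\<integral>\<^sup>+\<omega>. inverse s\<^sub>\<tau> * (ennreal (chi \<alpha> (\<tau> (Z \<omega>))) * indicator D (\<Pi>\<^sub>\<tau> (Z \<omega>))) \<partial>P)"
    by (simp add: divide_ennreal_def ac_simps)
  also have "\<dots> = inverse s\<^sub>\<tau> * emeasure (section_measure P Z) D"
    unfolding emeasure_section_measure[OF Z D] by (rule nn_integral_cmult) measurable
  finally show "emeasure (distr ?T \<Sigma>\<^sub>\<tau> (\<lambda>\<omega>. \<Pi>\<^sub>\<tau> (Z \<omega>))) D = emeasure Q\<^sub>\<tau> D"
    by (simp add: sec varsigma_normalized_def)
qed simp

lemma prob_space_tilted:
  assumes Z [measurable]: "Z \<in> P \<rightarrow>\<^sub>M M" and sec: "section_measure P Z = \<sigma>\<^sub>\<tau>"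
  shows "prob_space (tilted_measure M S \<alpha> \<nu> \<tau> w P Z)"
proof (rule prob_space_distrD)
  show "(\<lambda>\<omega>. \<Pi>\<^sub>\<tau> (Z \<omega>)) \<in> tilted_measure M S \<alpha> \<nu> \<tau> w P Z \<rightarrow>\<^sub>M \<Sigma>\<^sub>\<tau>" by measurable
  show "prob_space (distr (tilted_measure M S \<alpha> \<nu> \<tau> w P Z) \<Sigma>\<^sub>\<tau> (\<lambda>\<omega>. \<Pi>\<^sub>\<tau> (Z \<omega>)))"
    unfolding tilted_law[OF assms] by (rule prob_space_normalized)
qed

lemma measurable_action_a_vec: "S a\<^sub>\<tau> \<in> \<Sigma>\<^sub>\<tau> \<rightarrow>\<^sub>M M"
  by (rule measurable_compose[OF measurable_section_inclusion measurable_action_at[OF a_vec_pos]])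

lemma action_a_vec_section:
  assumes "y \<in> space \<Sigma>\<^sub>\<tau>"
  shows "\<tau> (S a\<^sub>\<tau> y) = a\<^sub>\<tau>" "\<Pi>\<^sub>\<tau> (S a\<^sub>\<tau> y) = y"
  using sectionD[OF assms] proj_on_section[OF assms]
  by (simp_all add: gauge_action a_vec_pos proj_action)

text \<open>
  With the gauge frozen at \<open>a\<^sub>\<tau>\<close>, the weight is the constant \<open>s\<^sub>\<tau>\<close>, so the section measure is \<open>s\<^sub>\<tau>\<close>
  times the law of the section point.
\<close>

lemma representer_of_constant_gauge:
  assumes P: "prob_space P" and W: "W \<in> P \<rightarrow>\<^sub>M M"
    and const: "\<And>\<omega>. \<omega> \<in> space P \<Longrightarrow> \<tau> (W \<omega>) = a\<^sub>\<tau>"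
    and law: "distr P \<Sigma>\<^sub>\<tau> (\<lambda>\<omega>. \<Pi>\<^sub>\<tau> (W \<omega>)) = Q\<^sub>\<tau>"
  shows "stochastic_representer M S \<alpha> \<nu> P W"
proof -
  have "section_measure P W = \<sigma>\<^sub>\<tau>"
    using section_measure_constant_gauge[OF W, of "a\<^sub>\<tau>"] const
    by (simp add: law chi_a_vec scale_normalized)
  moreover have "AE \<omega> in P. W \<omega> \<in> E\<^sub>\<tau>"
    by (rule AE_I2) (simp add: dom_iff const a_vec_pos measurable_space[OF W])
  ultimately have "orbit_measure M S \<alpha> P W = \<nu>"
    using orbit_measure_eq_iff[OF W] by simp
  then show ?thesis
    unfolding stochastic_representer_def random_element_def using P W by (intro conjI) simp_all
qed

text \<open>
  The criterion determines the law of the section point, and \<open>W\<close> is recovered from it by the fixed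
  map \<open>S a\<^sub>\<tau>\<close>.
\<close>

lemma law_of_constant_gauge_representer:
  assumes rep: "stochastic_representer M S \<alpha> \<nu> P W" and const: "AE \<omega> in P. \<tau> (W \<omega>) = a\<^sub>\<tau>"
  shows "distr P M W = distr Q\<^sub>\<tau> M (S a\<^sub>\<tau>)"
proof -
  have W [measurable]: "W \<in> P \<rightarrow>\<^sub>M M"
    using rep by (simp only: stochastic_representer_def random_element_def)
  note measurable_action_a_vec [measurable]
  have law: "distr P \<Sigma>\<^sub>\<tau> (\<lambda>\<omega>. \<Pi>\<^sub>\<tau> (W \<omega>)) = Q\<^sub>\<tau>"
    using section_measure_constant_gauge[OF W const] section_measure_representer(1)[OF rep]
    by (simp add: chi_a_vec flip: eq_normalized_iff)
  have "distr P M W = distr P M (\<lambda>\<omega>. S a\<^sub>\<tau> (\<Pi>\<^sub>\<tau> (W \<omega>)))"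
  proof (rule distr_cong_AE[OF refl refl])
    show "AE \<omega> in P. W \<omega> = S a\<^sub>\<tau> (\<Pi>\<^sub>\<tau> (W \<omega>))"
      using const section_measure_representer(2)[OF rep]
    proof eventually_elim
      case (elim \<omega>)
      then show ?case using action_gauge_proj[of "W \<omega>"] by simp
    qed
  qed measurable
  also have "\<dots> = distr (distr P \<Sigma>\<^sub>\<tau> (\<lambda>\<omega>. \<Pi>\<^sub>\<tau> (W \<omega>))) M (S a\<^sub>\<tau>)"
    by (subst distr_distr) (simp_all add: comp_def)
  finally show ?thesis by (simp only: law)
qed

text \<open>
  The witness is \<open>S a\<^sub>\<tau> y\<close> for \<open>y\<close> drawn from the normalised section measure. Its gauge is constant, hence
  independent of everything.
\<close>

lemma independent_representer_exists:
  "stochastic_representer M S \<alpha> \<nu> Q\<^sub>\<tau> (S a\<^sub>\<tau>)"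
  "independent_elements Q\<^sub>\<tau> borel (\<lambda>y. \<tau> (S a\<^sub>\<tau> y)) \<Sigma>\<^sub>\<tau> (\<lambda>y. \<Pi>\<^sub>\<tau> (S a\<^sub>\<tau> y))"
proof -
  interpret Q: prob_space "Q\<^sub>\<tau>" by (rule prob_space_normalized)
  have Sa [measurable]: "S a\<^sub>\<tau> \<in> Q\<^sub>\<tau> \<rightarrow>\<^sub>M M"
    using measurable_action_a_vec by (simp cong: measurable_cong_sets)
  have "distr Q\<^sub>\<tau> \<Sigma>\<^sub>\<tau> (\<lambda>y. \<Pi>\<^sub>\<tau> (S a\<^sub>\<tau> y)) = distr Q\<^sub>\<tau> Q\<^sub>\<tau> (\<lambda>y. y)"
    by (intro distr_cong) (simp_all add: space_normalized action_a_vec_section)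
  then show "stochastic_representer M S \<alpha> \<nu> Q\<^sub>\<tau> (S a\<^sub>\<tau>)"
    by (intro representer_of_constant_gauge[OF prob_space_normalized Sa])
      (simp_all add: space_normalized action_a_vec_section)
  show "independent_elements Q\<^sub>\<tau> borel (\<lambda>y. \<tau> (S a\<^sub>\<tau> y)) \<Sigma>\<^sub>\<tau> (\<lambda>y. \<Pi>\<^sub>\<tau> (S a\<^sub>\<tau> y))"
    by (rule Q.independent_elements_const)
      (measurable, simp add: space_normalized action_a_vec_section)
qed

lemma Z_circ_eq: "Z_circ M S \<alpha> \<nu> \<tau> w Z = (\<lambda>\<omega>. S a\<^sub>\<tau> (\<Pi>\<^sub>\<tau> (Z \<omega>)))"
  by (simp add: Z_circ_def fun_eq_iff)

text \<open>
  This holds everywhere, not only almost surely: where the gauge of \<open>Z\<close> vanishes in some coordinate,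
  \<open>\<Pi>\<^sub>\<tau>\<close> takes the value \<open>w\<close>, which lies on the section.
\<close>

lemma gauge_Z_circ:
  "Z \<omega> \<in> space M \<Longrightarrow> \<tau> (Z_circ M S \<alpha> \<nu> \<tau> w Z \<omega>) = a\<^sub>\<tau>"
  by (simp add: Z_circ_eq action_a_vec_section proj_section)

lemma Z_circ_on_dom:
  assumes "Z \<omega> \<in> E\<^sub>\<tau>"
  shows "Z_circ M S \<alpha> \<nu> \<tau> w Z \<omega> = S (a\<^sub>\<tau> * vec_inv (\<tau> (Z \<omega>))) (Z \<omega>)"
  using assms dom_iff[of "Z \<omega>"] by (simp add: Z_circ_eq section_proj_def action_mult a_vec_pos)

lemma representer_Z_circ:
  assumes Z [measurable]: "Z \<in> P \<rightarrow>\<^sub>M M" and sec: "section_measure P Z = \<sigma>\<^sub>\<tau>"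
  shows "stochastic_representer M S \<alpha> \<nu> (tilted_measure M S \<alpha> \<nu> \<tau> w P Z) (Z_circ M S \<alpha> \<nu> \<tau> w Z)"
proof (rule representer_of_constant_gauge[OF prob_space_tilted[OF assms]])
  note measurable_action_a_vec [measurable]
  let ?T = "tilted_measure M S \<alpha> \<nu> \<tau> w P Z"
  have spT: "space ?T = space P" by (simp add: tilted_measure_def)
  show "Z_circ M S \<alpha> \<nu> \<tau> w Z \<in> ?T \<rightarrow>\<^sub>M M" unfolding Z_circ_eq by measurable
  show "\<tau> (Z_circ M S \<alpha> \<nu> \<tau> w Z \<omega>) = a\<^sub>\<tau>" if "\<omega> \<in> space ?T" for \<omega>
    using that measurable_space[OF Z] by (simp add: spT gauge_Z_circ)
  have "distr ?T \<Sigma>\<^sub>\<tau> (\<lambda>\<omega>. \<Pi>\<^sub>\<tau> (Z_circ M S \<alpha> \<nu> \<tau> w Z \<omega>)) = distr ?T \<Sigma>\<^sub>\<tau> (\<lambda>\<omega>. \<Pi>\<^sub>\<tau> (Z \<omega>))"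
    by (intro distr_cong)
      (simp_all add: spT Z_circ_eq action_a_vec_section proj_section measurable_space[OF Z])
  then show "distr ?T \<Sigma>\<^sub>\<tau> (\<lambda>\<omega>. \<Pi>\<^sub>\<tau> (Z_circ M S \<alpha> \<nu> \<tau> w Z \<omega>)) = Q\<^sub>\<tau>"
    by (simp add: tilted_law[OF assms])
qed

text \<open>
  Under independence the section measure is a scaled probability measure. The scale is its total
  mass, so equality with \<open>\<sigma>\<^sub>\<tau>\<close> separates into equality of masses and of normalised laws.
\<close>

lemma independent_representer_iff:
  assumes P: "prob_space P" and Z [measurable]: "Z \<in> P \<rightarrow>\<^sub>M M" and conc: "AE \<omega> in P. Z \<omega> \<in> E\<^sub>\<tau>"
    and ind: "independent_elements P borel (\<lambda>\<omega>. \<tau> (Z \<omega>)) \<Sigma>\<^sub>\<tau> (\<lambda>\<omega>. \<Pi>\<^sub>\<tau> (Z \<omega>))"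
  shows "orbit_measure M S \<alpha> P Z = \<nu> \<longleftrightarrow>
    distr P \<Sigma>\<^sub>\<tau> (\<lambda>\<omega>. \<Pi>\<^sub>\<tau> (Z \<omega>)) = Q\<^sub>\<tau> \<and> (\<integral>\<^sup>+\<omega>. ennreal (chi \<alpha> (\<tau> (Z \<omega>))) \<partial>P) = s\<^sub>\<tau>"
  (is "_ \<longleftrightarrow> ?L = _ \<and> ?m = _")
proof -
  have sec: "section_measure P Z = scale_measure ?m ?L"
    by (rule section_measure_independent[OF P Z ind])
  have "section_measure P Z = \<sigma>\<^sub>\<tau> \<longleftrightarrow> ?L = Q\<^sub>\<tau> \<and> ?m = s\<^sub>\<tau>"
  proof
    assume eq: "section_measure P Z = \<sigma>\<^sub>\<tau>"
    have m: "?m = s\<^sub>\<tau>"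
      using emeasure_section_measure_space[OF Z] by (simp add: eq s_const_eq)
    then have "scale_measure s\<^sub>\<tau> ?L = \<sigma>\<^sub>\<tau>"
      using sec eq by simp
    then show "?L = Q\<^sub>\<tau> \<and> ?m = s\<^sub>\<tau>"
      using m by (simp add: eq_normalized_iff)
  qed (simp add: sec scale_normalized)
  then show ?thesis
    by (simp only: orbit_measure_eq_iff[OF Z conc])
qed

end

end

section \<open>The characterisation of independent representers\<close>

theorem corollary3p3:
  fixes M :: "'e measure"
    and S :: "real ^ 'q \<Rightarrow> 'e \<Rightarrow> 'e"
    and \<alpha> :: "real ^ 'q"
    and \<nu> :: "'e measure"
    and \<tau> :: "'e \<Rightarrow> real ^ 'q"
    and w :: 'e
  assumes "\<alpha> \<in> pos_orthant"
    and "measurable_action M S"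
    and "\<nu> \<in> homogeneous_measures M S \<alpha>"
    and "admissible_gauge M S \<nu> \<tau>"
    and "w \<in> gauge_section M \<tau>"
  shows
    "(s_const M S \<alpha> \<nu> \<tau> w =
        inverse (d_const \<alpha>) *
          (\<integral>\<^sup>+x\<in>{x\<in>space M. \<tau> x \<in> C_star}. ennreal (chi \<alpha> (\<tau> x)) \<partial>\<nu>)
      \<and> s_const M S \<alpha> \<nu> \<tau> w =
          emeasure \<nu> {x\<in>space M. \<tau> x \<in> C_star} / emeasure (theta \<alpha>) C_star
      \<and> 0 < s_const M S \<alpha> \<nu> \<tau> w)
    \<and> (\<forall>(P :: 'w measure) Z. stochastic_representer M S \<alpha> \<nu> P Z \<longrightarrow>
        (\<integral>\<^sup>+\<omega>. ennreal (chi \<alpha> (\<tau> (Z \<omega>))) \<partial>P) = s_const M S \<alpha> \<nu> \<tau> w)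
    \<and> ((\<exists>(P :: 'e measure) Z. stochastic_representer M S \<alpha> \<nu> P Z \<and>
          independent_elements P borel (\<lambda>\<omega>. \<tau> (Z \<omega>))
            (section_space M \<tau>) (\<lambda>\<omega>. section_proj M S \<tau> w (Z \<omega>)))
        \<longleftrightarrow> s_const M S \<alpha> \<nu> \<tau> w < \<infinity>)
    \<and> (\<forall>(P :: 'w measure) Z. stochastic_representer M S \<alpha> \<nu> P Z \<and>
          independent_elements P borel (\<lambda>\<omega>. \<tau> (Z \<omega>))
            (section_space M \<tau>) (\<lambda>\<omega>. section_proj M S \<tau> w (Z \<omega>))
        \<longrightarrow> s_const M S \<alpha> \<nu> \<tau> w < \<infinity>)
    \<and> (s_const M S \<alpha> \<nu> \<tau> w < \<infinity> \<longleftrightarrow> emeasure \<nu> {x\<in>space M. \<tau> x \<in> C_star} < \<infinity>)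
    \<and> (s_const M S \<alpha> \<nu> \<tau> w < \<infinity> \<longrightarrow>
        a_vec M S \<alpha> \<nu> \<tau> w \<in> pos_orthant
      \<and> (\<forall>(P :: 'w measure) Z. stochastic_representer M S \<alpha> \<nu> P Z \<longrightarrow>
            (AE \<omega> in P. Z_circ M S \<alpha> \<nu> \<tau> w Z \<omega> =
               S (a_vec M S \<alpha> \<nu> \<tau> w * vec_inv (\<tau> (Z \<omega>))) (Z \<omega>))
          \<and> prob_space (tilted_measure M S \<alpha> \<nu> \<tau> w P Z)
          \<and> distr (tilted_measure M S \<alpha> \<nu> \<tau> w P Z) (section_space M \<tau>)
                (\<lambda>\<omega>. section_proj M S \<tau> w (Z \<omega>)) = varsigma_normalized M S \<alpha> \<nu> \<tau> w
          \<and> (\<forall>\<omega>\<in>space P. \<tau> (Z_circ M S \<alpha> \<nu> \<tau> w Z \<omega>) = a_vec M S \<alpha> \<nu> \<tau> w)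
          \<and> stochastic_representer M S \<alpha> \<nu> (tilted_measure M S \<alpha> \<nu> \<tau> w P Z)
                (Z_circ M S \<alpha> \<nu> \<tau> w Z)
          \<and> distr (tilted_measure M S \<alpha> \<nu> \<tau> w P Z) M (Z_circ M S \<alpha> \<nu> \<tau> w Z) =
                distr (varsigma_normalized M S \<alpha> \<nu> \<tau> w) M (S (a_vec M S \<alpha> \<nu> \<tau> w)))
      \<and> (\<forall>(P :: 'w measure) W. stochastic_representer M S \<alpha> \<nu> P W \<and>
            (AE \<omega> in P. \<tau> (W \<omega>) = a_vec M S \<alpha> \<nu> \<tau> w) \<longrightarrow>
            distr P M W =
              distr (varsigma_normalized M S \<alpha> \<nu> \<tau> w) M (S (a_vec M S \<alpha> \<nu> \<tau> w)))
      \<and> (\<forall>(P :: 'w measure) Z. random_element P M Z \<and>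
            (AE \<omega> in P. Z \<omega> \<in> gauge_dom M \<tau>) \<and>
            independent_elements P borel (\<lambda>\<omega>. \<tau> (Z \<omega>))
              (section_space M \<tau>) (\<lambda>\<omega>. section_proj M S \<tau> w (Z \<omega>)) \<longrightarrow>
            (orbit_measure M S \<alpha> P Z = \<nu> \<longleftrightarrow>
              distr P (section_space M \<tau>) (\<lambda>\<omega>. section_proj M S \<tau> w (Z \<omega>)) =
                varsigma_normalized M S \<alpha> \<nu> \<tau> w
              \<and> (\<integral>\<^sup>+\<omega>. ennreal (chi \<alpha> (\<tau> (Z \<omega>))) \<partial>P) = s_const M S \<alpha> \<nu> \<tau> w)))"
proof -
  interpret homogeneous_gauged_action M S \<alpha> \<tau> w \<nu>
    using assms by unfold_locales (simp_all add: admissible_gauge_def)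
  have repD: "Z \<in> P \<rightarrow>\<^sub>M M" "section_measure P Z = \<sigma>\<^sub>\<tau>" "AE \<omega> in P. Z \<omega> \<in> E\<^sub>\<tau>"
    if "stochastic_representer M S \<alpha> \<nu> P Z" for P :: "'w measure" and Z
    using that section_measure_representer[OF that]
    by (simp_all only: stochastic_representer_def random_element_def)
  show ?thesis
  proof (intro conjI allI impI iffI; (elim conjE exE)?)
    show "s\<^sub>\<tau> = inverse (d_const \<alpha>) *
        (\<integral>\<^sup>+x\<in>{x\<in>space M. \<tau> x \<in> C_star}. ennreal (chi \<alpha> (\<tau> x)) \<partial>\<nu>)"
      by (rule s_const_eq_integral)
    show "s\<^sub>\<tau> = emeasure \<nu> {x\<in>space M. \<tau> x \<in> C_star} / emeasure (theta \<alpha>) C_star"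
      by (rule s_const_eq_quotient)
    show "0 < s\<^sub>\<tau>" by (rule s_const_pos)
    show "(\<integral>\<^sup>+\<omega>. ennreal (chi \<alpha> (\<tau> (Z \<omega>))) \<partial>P) = s\<^sub>\<tau>"
      if "stochastic_representer M S \<alpha> \<nu> P Z" for P :: "'w measure" and Z
      using emeasure_section_measure_space[OF repD(1)[OF that]]
      by (simp add: repD(2)[OF that] s_const_eq)
    show "s\<^sub>\<tau> < \<infinity>"
      if "stochastic_representer M S \<alpha> \<nu> P Z"
        "independent_elements P borel (\<lambda>\<omega>. \<tau> (Z \<omega>)) \<Sigma>\<^sub>\<tau> (\<lambda>\<omega>. \<Pi>\<^sub>\<tau> (Z \<omega>))"
      for P :: "'e measure" and Z
      using that by (rule s_const_finite_of_independent)
    show "\<exists>(P :: 'e measure) Z. stochastic_representer M S \<alpha> \<nu> P Z \<and>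
        independent_elements P borel (\<lambda>\<omega>. \<tau> (Z \<omega>)) \<Sigma>\<^sub>\<tau> (\<lambda>\<omega>. \<Pi>\<^sub>\<tau> (Z \<omega>))" if "s\<^sub>\<tau> < \<infinity>"
      using independent_representer_exists[OF that] by blast
    show "s\<^sub>\<tau> < \<infinity>"
      if "stochastic_representer M S \<alpha> \<nu> P Z"
        "independent_elements P borel (\<lambda>\<omega>. \<tau> (Z \<omega>)) \<Sigma>\<^sub>\<tau> (\<lambda>\<omega>. \<Pi>\<^sub>\<tau> (Z \<omega>))"
      for P :: "'w measure" and Z
      using that by (rule s_const_finite_of_independent)
    show "emeasure \<nu> {x\<in>space M. \<tau> x \<in> C_star} < \<infinity>" if "s\<^sub>\<tau> < \<infinity>"
      using that by (simp only: s_const_finite_iff)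
    show "s\<^sub>\<tau> < \<infinity>" if "emeasure \<nu> {x\<in>space M. \<tau> x \<in> C_star} < \<infinity>"
      using that by (simp only: s_const_finite_iff)
  next
    assume fin: "s\<^sub>\<tau> < \<infinity>"
    show "a\<^sub>\<tau> \<in> pos_orthant" by (rule a_vec_pos[OF fin])
    fix P :: "'w measure" and Z
    assume rep: "stochastic_representer M S \<alpha> \<nu> P Z"
    note Z = repD(1)[OF rep] and sec = repD(2)[OF rep] and conc = repD(3)[OF rep]
    let ?T = "tilted_measure M S \<alpha> \<nu> \<tau> w P Z" and ?Z = "Z_circ M S \<alpha> \<nu> \<tau> w Z"
    show "AE \<omega> in P. ?Z \<omega> = S (a\<^sub>\<tau> * vec_inv (\<tau> (Z \<omega>))) (Z \<omega>)"
      by (rule AE_mp[OF conc], rule AE_I2, rule impI, rule Z_circ_on_dom[OF fin])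
    show "prob_space ?T" by (rule prob_space_tilted[OF fin Z sec])
    show "distr ?T \<Sigma>\<^sub>\<tau> (\<lambda>\<omega>. \<Pi>\<^sub>\<tau> (Z \<omega>)) = Q\<^sub>\<tau>" by (rule tilted_law[OF fin Z sec])
    show gauge_Z: "\<forall>\<omega>\<in>space P. \<tau> (?Z \<omega>) = a\<^sub>\<tau>"
      using measurable_space[OF Z] by (intro ballI gauge_Z_circ[OF fin])
    show rep': "stochastic_representer M S \<alpha> \<nu> ?T ?Z"
      by (rule representer_Z_circ[OF fin Z sec])
    show "distr ?T M ?Z = distr Q\<^sub>\<tau> M (S a\<^sub>\<tau>)"
      by (rule law_of_constant_gauge_representer[OF fin rep'], rule AE_I2)
        (use gauge_Z in \<open>simp add: tilted_measure_def\<close>)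
  next
    fix P :: "'w measure" and W
    assume fin: "s\<^sub>\<tau> < \<infinity>" and "stochastic_representer M S \<alpha> \<nu> P W"
      and "AE \<omega> in P. \<tau> (W \<omega>) = a\<^sub>\<tau>"
    then show "distr P M W = distr Q\<^sub>\<tau> M (S a\<^sub>\<tau>)"
      by (rule law_of_constant_gauge_representer)
  next
    fix P :: "'w measure" and Z
    assume fin: "s\<^sub>\<tau> < \<infinity>" and "random_element P M Z"
      and "AE \<omega> in P. Z \<omega> \<in> E\<^sub>\<tau>"
      and "independent_elements P borel (\<lambda>\<omega>. \<tau> (Z \<omega>)) \<Sigma>\<^sub>\<tau> (\<lambda>\<omega>. \<Pi>\<^sub>\<tau> (Z \<omega>))"
    then have iff: "orbit_measure M S \<alpha> P Z = \<nu> \<longleftrightarrow>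
        distr P \<Sigma>\<^sub>\<tau> (\<lambda>\<omega>. \<Pi>\<^sub>\<tau> (Z \<omega>)) = Q\<^sub>\<tau> \<and> (\<integral>\<^sup>+\<omega>. ennreal (chi \<alpha> (\<tau> (Z \<omega>))) \<partial>P) = s\<^sub>\<tau>"
      by (intro independent_representer_iff) (simp_all add: random_element_def)
    show "distr P \<Sigma>\<^sub>\<tau> (\<lambda>\<omega>. \<Pi>\<^sub>\<tau> (Z \<omega>)) = Q\<^sub>\<tau>" if "orbit_measure M S \<alpha> P Z = \<nu>"
      using that iff by blast
    show "(\<integral>\<^sup>+\<omega>. ennreal (chi \<alpha> (\<tau> (Z \<omega>))) \<partial>P) = s\<^sub>\<tau>" if "orbit_measure M S \<alpha> P Z = \<nu>"
      using that iff by blast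
    show "orbit_measure M S \<alpha> P Z = \<nu>" if "distr P \<Sigma>\<^sub>\<tau> (\<lambda>\<omega>. \<Pi>\<^sub>\<tau> (Z \<omega>)) = Q\<^sub>\<tau>"
      "(\<integral>\<^sup>+\<omega>. ennreal (chi \<alpha> (\<tau> (Z \<omega>))) \<partial>P) = s\<^sub>\<tau>"
      using that iff by blast
  qed
qed

end
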